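(* Let $K/F$ be a computable algebraic field extension for which the degree map $\deg_F:K\to\mathbb{N}$ is computable, and let $C\subseteq\omega$ be a cohesive set. Then $\prod_C K/\prod_C F$ is algebraic if and only if $\{\deg_F(\alpha)\mid\alpha\in K\}$ is bounded.
   Context: For $A,B\subseteq\omega$, $A\subseteq^* B$ means $A\setminus B$ is finite. A set $C\subseteq\omega$ is cohesive if it is infinite and for every c.e. set $W$ either $C\subseteq^*W$ or $C\subseteq^*\overline{W}$. A computable structure has computable domain $\subseteq\omega$ and computable atomic diagram. For a computable structure $\mathcal A$ and cohesive $C$, the cohesive power $\prod_C\mathcal A$ has as domain the classes $[\varphi]$ of partial computable functions $\varphi$ from $\omega$ to $\mathcal{A}$ with $C\subseteq^*\mathrm{dom}(\varphi)$, where $[\varphi]=[\psi]$ iff $C\subseteq^*\{i:\varphi(i){\downarrow}=\psi(i){\downarrow}\}$; functions and constants are interpreted pointwise. A computable field extension $K/F$ is a triple $(K,F,\Psi)$ with $K,F$ computable fields and $\Psi:F\to K$ a computable ring homomorphism; $F$ is identified with its image. $\prod_CF$ is regarded as a subfield of $\prod_CK$ via $[\alpha]\mapsto[\Psi\circ\alpha]$. For $\alpha\in K$ algebraic over $F$, $\deg_F(\alpha)=[F(\alpha):F]$ is the degree of its minimal polynomial. *)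

theory Defs
  imports "HOL-Algebra.Algebra" "HOL-Library.Nat_Bijection"
begin

section \<open>Computability on the natural numbers\<close>

text \<open>Kleene's partial recursive functions. Arities are not tracked: an application to too few
  arguments is undefined and surplus arguments are ignored.\<close>

datatype recf =
    Zero
  | Succ
  | Proj nat
  | Comp recf "recf list"
  | PrimRec recf recf
  | Mu recf

text \<open>In the clause for \<open>Mu\<close>, all values below the root have to be defined.\<close>

primrec rf_eval :: "recf \<Rightarrow> nat list \<Rightarrow> nat option" where
  "rf_eval Zero = (\<lambda>xs. Some 0)"
| "rf_eval Succ = (\<lambda>xs. case xs of [] \<Rightarrow> None | x # _ \<Rightarrow> Some (Suc x))"
| "rf_eval (Proj i) = (\<lambda>xs. if i < length xs then Some (xs ! i) else None)"
| "rf_eval (Comp f gs) = (\<lambda>xs.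
     let ys = map (\<lambda>g. g xs) (map rf_eval gs)
     in if None \<in> set ys then None else rf_eval f (map the ys))"
| "rf_eval (PrimRec f g) = (\<lambda>xs. case xs of [] \<Rightarrow> None
     | n # zs \<Rightarrow> rec_nat (rf_eval f zs)
                   (\<lambda>m r. Option.bind r (\<lambda>y. rf_eval g (m # y # zs))) n)"
| "rf_eval (Mu f) = (\<lambda>xs.
     let root = (\<lambda>n. rf_eval f (n # xs) = Some 0
                      \<and> (\<forall>m<n. \<exists>y. rf_eval f (m # xs) = Some (Suc y)))
     in if \<exists>n. root n then Some (THE n. root n) else None)"

definition partial_computable :: "(nat \<rightharpoonup> nat) \<Rightarrow> bool" where
  "partial_computable \<phi> \<longleftrightarrow> (\<exists>f. \<forall>x. \<phi> x = rf_eval f [x])"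

definition computable_set :: "nat set \<Rightarrow> bool" where
  "computable_set S \<longleftrightarrow> partial_computable (\<lambda>x. Some (if x \<in> S then 1 else 0))"

definition ce_set :: "nat set \<Rightarrow> bool" where
  "ce_set W \<longleftrightarrow> (\<exists>\<phi>. partial_computable \<phi> \<and> W = dom \<phi>)"

definition computable_on :: "nat set \<Rightarrow> (nat \<Rightarrow> nat) \<Rightarrow> bool" where
  "computable_on D f \<longleftrightarrow> (\<exists>\<phi>. partial_computable \<phi> \<and> (\<forall>x\<in>D. \<phi> x = Some (f x)))"

definition almost_subset :: "nat set \<Rightarrow> nat set \<Rightarrow> bool" (infix "\<subseteq>\<^sup>*" 50) where
  "A \<subseteq>\<^sup>* B \<longleftrightarrow> finite (A - B)"

definition cohesive :: "nat set \<Rightarrow> bool" where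
  "cohesive C \<longleftrightarrow> infinite C \<and> (\<forall>W. ce_set W \<longrightarrow> C \<subseteq>\<^sup>* W \<or> C \<subseteq>\<^sup>* - W)"

section \<open>Computable structures in the language of rings\<close>

text \<open>Closed terms over the signature \<open>0, 1, +, *\<close> extended by a name for each element.\<close>

datatype (term_elems: 'a) ring_term =
    Elem 'a
  | TZero
  | TOne
  | TAdd "'a ring_term" "'a ring_term"
  | TMult "'a ring_term" "'a ring_term"

primrec term_val :: "('a, 'm) ring_scheme \<Rightarrow> 'a ring_term \<Rightarrow> 'a" where
  "term_val R (Elem a) = a"
| "term_val R TZero = \<zero>\<^bsub>R\<^esub>"
| "term_val R TOne = \<one>\<^bsub>R\<^esub>"
| "term_val R (TAdd s t) = term_val R s \<oplus>\<^bsub>R\<^esub> term_val R t"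
| "term_val R (TMult s t) = term_val R s \<otimes>\<^bsub>R\<^esub> term_val R t"

primrec term_code :: "nat ring_term \<Rightarrow> nat" where
  "term_code (Elem a) = prod_encode (0, a)"
| "term_code TZero = prod_encode (1, 0)"
| "term_code TOne = prod_encode (2, 0)"
| "term_code (TAdd s t) = prod_encode (3, prod_encode (term_code s, term_code t))"
| "term_code (TMult s t) = prod_encode (4, prod_encode (term_code s, term_code t))"

text \<open>The only relation symbol is equality, so the atomic sentences are the equations between
  closed terms. A negated equation is in the diagram exactly if the equation is not, so it
  suffices to list the true equations.\<close>

definition atomic_diagram :: "nat ring \<Rightarrow> nat set" where
  "atomic_diagram R =
     {prod_encode (term_code s, term_code t) | s t.
        term_elems s \<subseteq> carrier R \<and> term_elems t \<subseteq> carrier R \<and> term_val R s = term_val R t}"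

definition computable_field :: "nat ring \<Rightarrow> bool" where
  "computable_field R \<longleftrightarrow>
     field R \<and> computable_set (carrier R) \<and> computable_set (atomic_diagram R)"

definition computable_field_extension :: "nat ring \<Rightarrow> nat ring \<Rightarrow> (nat \<Rightarrow> nat) \<Rightarrow> bool" where
  "computable_field_extension K F \<Psi> \<longleftrightarrow>
     computable_field K \<and> computable_field F \<and> \<Psi> \<in> ring_hom F K \<and> computable_on (carrier F) \<Psi>"

section \<open>Algebraic extensions and degrees\<close>

definition algebraic_extension :: "('a, 'm) ring_scheme \<Rightarrow> 'a set \<Rightarrow> bool" where
  "algebraic_extension L k \<longleftrightarrow> (\<forall>\<alpha>\<in>carrier L. (ring.algebraic L over k) \<alpha>)"

definition deg_over :: "('a, 'm) ring_scheme \<Rightarrow> 'a set \<Rightarrow> 'a \<Rightarrow> nat" where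
  "deg_over L k \<alpha> = degree (ring.Irr L k \<alpha>)"

lemma deg_over_eq_dim:
  fixes L (structure)
  assumes "field L" "subfield k L" "\<alpha> \<in> carrier L" "(ring.algebraic L over k) \<alpha>"
  shows "deg_over L k \<alpha> = (ring.dim L over k) (ring.simple_extension L k \<alpha>)"
proof -
  interpret field L by fact
  show ?thesis
    using dimI[OF assms(2) dimension_simple_extension[OF assms(2,3,4)]] by (simp add: deg_over_def)
qed

section \<open>Cohesive powers\<close>

definition cohesive_funs :: "nat set \<Rightarrow> nat ring \<Rightarrow> (nat \<rightharpoonup> nat) set" where
  "cohesive_funs C R = {\<phi>. partial_computable \<phi> \<and> ran \<phi> \<subseteq> carrier R \<and> C \<subseteq>\<^sup>* dom \<phi>}"

definition cohesive_eq :: "nat set \<Rightarrow> nat ring \<Rightarrow> (nat \<rightharpoonup> nat) rel" where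
  "cohesive_eq C R = {(\<phi>, \<psi>). \<phi> \<in> cohesive_funs C R \<and> \<psi> \<in> cohesive_funs C R
     \<and> C \<subseteq>\<^sup>* {i. \<phi> i \<noteq> None \<and> \<phi> i = \<psi> i}}"

abbreviation cohesive_class :: "nat set \<Rightarrow> nat ring \<Rightarrow> (nat \<rightharpoonup> nat) \<Rightarrow> (nat \<rightharpoonup> nat) set" where
  "cohesive_class C R \<phi> \<equiv> cohesive_eq C R `` {\<phi>}"

lemma equiv_cohesive_eq: "equiv (cohesive_funs C R) (cohesive_eq C R)"
proof (rule equivI)
  show "cohesive_eq C R \<subseteq> cohesive_funs C R \<times> cohesive_funs C R"
    by (auto simp: cohesive_eq_def)
  show "refl_on (cohesive_funs C R) (cohesive_eq C R)"
    by (auto simp: refl_on_def cohesive_eq_def cohesive_funs_def dom_def)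
  show "sym (cohesive_eq C R)"
  proof (rule symI)
    fix \<phi> \<psi> assume *: "(\<phi>, \<psi>) \<in> cohesive_eq C R"
    have "{i. \<phi> i \<noteq> None \<and> \<phi> i = \<psi> i} = {i. \<psi> i \<noteq> None \<and> \<psi> i = \<phi> i}" by (rule Collect_cong) metis
    with * show "(\<psi>, \<phi>) \<in> cohesive_eq C R" unfolding cohesive_eq_def by auto
  qed
  show "trans (cohesive_eq C R)"
  proof (rule transI)
    fix \<phi> \<psi> \<chi>
    assume 1: "(\<phi>, \<psi>) \<in> cohesive_eq C R" and 2: "(\<psi>, \<chi>) \<in> cohesive_eq C R"
    have "C - {i. \<phi> i \<noteq> None \<and> \<phi> i = \<chi> i}
        \<subseteq> (C - {i. \<phi> i \<noteq> None \<and> \<phi> i = \<psi> i}) \<union> (C - {i. \<psi> i \<noteq> None \<and> \<psi> i = \<chi> i})"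
      by auto
    with 1 2 show "(\<phi>, \<chi>) \<in> cohesive_eq C R"
      unfolding cohesive_eq_def almost_subset_def by (auto intro: finite_subset)
  qed
qed

definition pointwise :: "(nat \<Rightarrow> nat \<Rightarrow> nat) \<Rightarrow> (nat \<rightharpoonup> nat) \<Rightarrow> (nat \<rightharpoonup> nat) \<Rightarrow> (nat \<rightharpoonup> nat)" where
  "pointwise f \<phi> \<psi> = (\<lambda>i. Option.bind (\<phi> i) (\<lambda>a. map_option (f a) (\<psi> i)))"

text \<open>The unions below are the usual way of lifting an operation to a quotient: all the classes
  that are united coincide, as the result does not depend on the representatives.\<close>

definition cohesive_power :: "nat set \<Rightarrow> nat ring \<Rightarrow> (nat \<rightharpoonup> nat) set ring" where
  "cohesive_power C R =
     \<lparr> carrier = cohesive_funs C R // cohesive_eq C R,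
       monoid.mult = (\<lambda>A B. \<Union>\<phi>\<in>A. \<Union>\<psi>\<in>B. cohesive_class C R (pointwise (\<otimes>\<^bsub>R\<^esub>) \<phi> \<psi>)),
       one = cohesive_class C R (\<lambda>i. Some \<one>\<^bsub>R\<^esub>),
       ring.zero = cohesive_class C R (\<lambda>i. Some \<zero>\<^bsub>R\<^esub>),
       add = (\<lambda>A B. \<Union>\<phi>\<in>A. \<Union>\<psi>\<in>B. cohesive_class C R (pointwise (\<oplus>\<^bsub>R\<^esub>) \<phi> \<psi>)) \<rparr>"

text \<open>The embedding of the power of \<open>F\<close> into the power of \<open>K\<close> that is induced by \<open>\<Psi>\<close>.\<close>

definition cohesive_embedding ::
  "nat set \<Rightarrow> nat ring \<Rightarrow> (nat \<Rightarrow> nat) \<Rightarrow> (nat \<rightharpoonup> nat) set \<Rightarrow> (nat \<rightharpoonup> nat) set" where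
  "cohesive_embedding C K \<Psi> A = (\<Union>\<alpha>\<in>A. cohesive_class C K (map_option \<Psi> \<circ> \<alpha>))"

end

theory Submission
  imports Defs
begin

text \<open>The power is an integral domain, because cohesiveness of \<open>C\<close> decides the c.e. set on which a
  partial computable function vanishes; identities in the power hold pointwise almost everywhere
  along \<open>C\<close>. If the degrees are bounded by \<open>d\<close>, then every \<open>\<phi>(i)\<close> is a root of a monic
  polynomial over \<open>F\<close> of degree exactly \<open>d\<close>; a search finds its coefficients computably in \<open>i\<close>, and
  together they form a monic polynomial over the power of \<open>F\<close> annihilating \<open>[\<phi>]\<close>. If the degrees
  are unbounded, let \<open>\<phi>(i)\<close> be the least element of degree larger than \<open>i\<close>. A nonzero polynomial
  annihilating \<open>[\<phi>]\<close> would give, for infinitely many \<open>i\<close>, a nonzero polynomial of the same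
  bounded length annihilating \<open>\<phi>(i)\<close>.\<close>

section \<open>Total recursive functions\<close>

text \<open>The arity is carried by the length of the list because \<open>rf_eval\<close> tracks
  none. Nothing is claimed for other lengths, so unspecified values such as \<open>xs ! i\<close>
  beyond the end do no harm.\<close>

definition total_rec :: "nat \<Rightarrow> (nat list \<Rightarrow> nat) \<Rightarrow> bool" where
  "total_rec k f \<longleftrightarrow> (\<exists>r. \<forall>xs. length xs = k \<longrightarrow> rf_eval r xs = Some (f xs))"

definition decidable :: "nat \<Rightarrow> (nat list \<Rightarrow> bool) \<Rightarrow> bool" where
  "decidable k P \<longleftrightarrow> total_rec k (\<lambda>xs. if P xs then 1 else 0)"

lemma total_rec_cong:
  assumes "total_rec k f" "\<And>xs. length xs = k \<Longrightarrow> f xs = g xs"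
  shows "total_rec k g"
  using assms unfolding total_rec_def by auto

lemma decidable_cong:
  assumes "decidable k P" "\<And>xs. length xs = k \<Longrightarrow> P xs = Q xs"
  shows "decidable k Q"
  using assms unfolding decidable_def by (auto elim!: total_rec_cong)

lemma total_rec_proj: "i < k \<Longrightarrow> total_rec k (\<lambda>xs. xs ! i)"
  unfolding total_rec_def by (intro exI[of _ "Proj i"]) auto

lemma total_rec_1D: "total_rec 1 f \<Longrightarrow> \<exists>r. \<forall>x. rf_eval r [x] = Some (f [x])"
  unfolding total_rec_def by (metis One_nat_def length_Cons list.size(3))

lemma total_rec_2D: "total_rec 2 f \<Longrightarrow> \<exists>r. \<forall>x y. rf_eval r [x, y] = Some (f [x, y])"
  unfolding total_rec_def by (metis numeral_2_eq_2 length_Cons list.size(3))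

lemma total_rec_comp:
  assumes f: "total_rec (length gs) f" and gs: "\<forall>g\<in>set gs. total_rec k g"
  shows "total_rec k (\<lambda>xs. f (map (\<lambda>g. g xs) gs))"
proof -
  obtain r where r: "\<And>xs. length xs = length gs \<Longrightarrow> rf_eval r xs = Some (f xs)"
    using f unfolding total_rec_def by auto
  obtain s where s: "\<And>g xs. g \<in> set gs \<Longrightarrow> length xs = k \<Longrightarrow> rf_eval (s g) xs = Some (g xs)"
    using gs unfolding total_rec_def by metis
  have "rf_eval (Comp r (map s gs)) xs = Some (f (map (\<lambda>g. g xs) gs))" if "length xs = k" for xs
  proof -
    have "map (\<lambda>g. g xs) (map rf_eval (map s gs)) = map (\<lambda>g. Some (g xs)) gs"
      using s that by auto
    moreover have "None \<notin> set (map (\<lambda>g. Some (g xs)) gs)" by auto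
    moreover have "map the (map (\<lambda>g. Some (g xs)) gs) = map (\<lambda>g. g xs) gs" by auto
    ultimately show ?thesis by (simp only: rf_eval.simps Let_def if_False r length_map)
  qed
  thus ?thesis unfolding total_rec_def by blast
qed

lemma total_rec_comp1: "total_rec 1 f \<Longrightarrow> total_rec k g \<Longrightarrow> total_rec k (\<lambda>xs. f [g xs])"
  using total_rec_comp[of "[g]" f k] by simp

lemma total_rec_comp2:
  "total_rec 2 f \<Longrightarrow> total_rec k g \<Longrightarrow> total_rec k h \<Longrightarrow> total_rec k (\<lambda>xs. f [g xs, h xs])"
  using total_rec_comp[of "[g, h]" f k] by (simp add: numeral_2_eq_2)

lemma total_rec_Suc: "total_rec k f \<Longrightarrow> total_rec k (\<lambda>xs. Suc (f xs))"
proof -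
  have "total_rec 1 (\<lambda>xs. Suc (xs ! 0))"
    unfolding total_rec_def by (intro exI[of _ Succ]) (auto split: list.split)
  thus "total_rec k f \<Longrightarrow> ?thesis" using total_rec_comp1 by fastforce
qed

lemma total_rec_const: "total_rec k (\<lambda>xs. c)"
proof (induction c)
  case 0 show ?case unfolding total_rec_def by (intro exI[of _ Zero]) auto
qed (rule total_rec_Suc)

text \<open>\<open>PrimRec\<close> recurses on the head of the list and hands index, previous value
  and parameters to the step in this order. Totality of both parts keeps every intermediate
  \<open>Option.bind\<close> defined.\<close>

lemma total_rec_rec_nat:
  assumes "total_rec k f" "total_rec (Suc (Suc k)) g"
  shows "total_rec (Suc k) (\<lambda>xs. rec_nat (f (tl xs)) (\<lambda>m y. g (m # y # tl xs)) (hd xs))"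
proof -
  obtain r where r: "\<And>xs. length xs = k \<Longrightarrow> rf_eval r xs = Some (f xs)"
    using assms unfolding total_rec_def by auto
  obtain s where s: "\<And>xs. length xs = Suc (Suc k) \<Longrightarrow> rf_eval s xs = Some (g xs)"
    using assms unfolding total_rec_def by auto
  have "rec_nat (rf_eval r xs) (\<lambda>m r. Option.bind r (\<lambda>y. rf_eval s (m # y # xs))) n
     = Some (rec_nat (f xs) (\<lambda>m y. g (m # y # xs)) n)" if "length xs = k" for xs n
    using that by (induction n) (simp_all add: r s)
  hence "\<forall>xs. length xs = Suc k \<longrightarrow> rf_eval (PrimRec r s) xs =
     Some (rec_nat (f (tl xs)) (\<lambda>m y. g (m # y # tl xs)) (hd xs))"
    by (auto split: list.split)
  thus ?thesis unfolding total_rec_def by blast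
qed

lemma total_rec_rec_nat1:
  assumes "total_rec 2 g" "total_rec k f"
  shows "total_rec k (\<lambda>xs. rec_nat c (\<lambda>m y. g [m, y]) (f xs))"
proof -
  have "total_rec 1 (\<lambda>xs. rec_nat c (\<lambda>m y. g (m # y # tl xs)) (hd xs))"
    using total_rec_rec_nat[OF total_rec_const, of 0 g c] assms(1) by (simp add: numeral_2_eq_2)
  hence "total_rec 1 (\<lambda>xs. rec_nat c (\<lambda>m y. g [m, y]) (hd xs))"
    by (rule total_rec_cong) (auto simp: length_Suc_conv)
  from total_rec_comp1[OF this assms(2)] show ?thesis by simp
qed

lemma total_rec_rec_nat2:
  assumes "total_rec 1 f" "total_rec 3 g" "total_rec k h" "total_rec k h'"
  shows "total_rec k (\<lambda>xs. rec_nat (f [h' xs]) (\<lambda>m y. g [m, y, h' xs]) (h xs))"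
proof -
  have "total_rec (Suc 1) (\<lambda>xs. rec_nat (f (tl xs)) (\<lambda>m y. g (m # y # tl xs)) (hd xs))"
    using total_rec_rec_nat[of 1 f g] assms(1,2) by (simp add: numeral_eq_Suc)
  hence "total_rec 2 (\<lambda>xs. rec_nat (f (tl xs)) (\<lambda>m y. g (m # y # tl xs)) (hd xs))"
    by (simp add: numeral_eq_Suc)
  from total_rec_comp2[OF this assms(3,4)] show ?thesis by simp
qed

section \<open>Arithmetic and the pairing function\<close>

lemma total_rec_add:
  assumes "total_rec k f" "total_rec k g"
  shows "total_rec k (\<lambda>xs. f xs + g xs)"
proof -
  have *: "rec_nat b (\<lambda>m y. Suc y) a = a + b" for a b by (induction a) auto
  have "total_rec 1 (\<lambda>xs. xs ! 0)" "total_rec 3 (\<lambda>xs. Suc (xs ! 1))"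
    by (intro total_rec_proj total_rec_Suc; simp)+
  from total_rec_rec_nat2[OF this assms] show ?thesis by (simp add: *)
qed

lemma total_rec_mult:
  assumes "total_rec k f" "total_rec k g"
  shows "total_rec k (\<lambda>xs. f xs * g xs)"
proof -
  have *: "rec_nat 0 (\<lambda>m y. y + b) a = a * b" for a b :: nat by (induction a) auto
  have "total_rec 1 (\<lambda>xs. 0)" "total_rec 3 (\<lambda>xs. xs ! 1 + xs ! 2)"
    by (intro total_rec_proj total_rec_add total_rec_const; simp)+
  from total_rec_rec_nat2[OF this assms] show ?thesis by (simp add: *)
qed

lemma total_rec_diff:
  assumes "total_rec k f" "total_rec k g"
  shows "total_rec k (\<lambda>xs. f xs - g xs)"
proof -
  \<comment> \<open>A recursion that discards the accumulated value and returns its index is the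
    predecessor. Truncated subtraction then iterates the predecessor.\<close>
  have *: "rec_nat 0 (\<lambda>m y. m) a = a - 1" for a :: nat by (induction a) auto
  have "total_rec 2 (\<lambda>xs. xs ! 0)" by (auto intro: total_rec_proj)
  from total_rec_rec_nat1[OF this, of 3 "\<lambda>xs. xs ! 1" 0]
  have "total_rec 3 (\<lambda>xs. xs ! 1 - 1)" by (simp add: total_rec_proj *)
  moreover have "total_rec 1 (\<lambda>xs. xs ! 0)" by (auto intro: total_rec_proj)
  ultimately have "total_rec k (\<lambda>xs. rec_nat (f xs) (\<lambda>m y. y - 1) (g xs))"
    using total_rec_rec_nat2[OF _ _ assms(2,1), of "\<lambda>xs. xs ! 0" "\<lambda>xs. xs ! 1 - 1"] by simp
  moreover have "rec_nat a (\<lambda>m y. y - 1) b = a - b" for a b :: nat by (induction b) auto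
  ultimately show ?thesis by simp
qed

text \<open>Triangle numbers are what the Cantor pairing needs: \<open>prod_encode (a, b)\<close> is
  \<open>triangle (a + b) + a\<close>.\<close>

lemma total_rec_triangle:
  assumes "total_rec k f"
  shows "total_rec k (\<lambda>xs. triangle (f xs))"
proof -
  have *: "rec_nat 0 (\<lambda>m y. y + Suc m) a = triangle a" for a by (induction a) auto
  have "total_rec 2 (\<lambda>xs. xs ! 1 + Suc (xs ! 0))"
    by (intro total_rec_proj total_rec_add total_rec_Suc) simp_all
  from total_rec_rec_nat1[OF this assms, of 0] * show ?thesis by simp
qed

lemma total_rec_prod_encode:
  assumes "total_rec k f" "total_rec k g"
  shows "total_rec k (\<lambda>xs. prod_encode (f xs, g xs))"
  unfolding prod_encode_def using assms
  by (simp add: total_rec_add total_rec_triangle)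

section \<open>Decidable predicates and definition by cases\<close>

lemma decidable_not: "decidable k P \<Longrightarrow> decidable k (\<lambda>xs. \<not> P xs)"
proof -
  assume "decidable k P"
  hence "total_rec k (\<lambda>xs. 1 - (if P xs then 1 else 0))"
    unfolding decidable_def by (intro total_rec_diff total_rec_const)
  thus ?thesis unfolding decidable_def by (rule total_rec_cong) auto
qed

lemma decidable_conj: "decidable k P \<Longrightarrow> decidable k Q \<Longrightarrow> decidable k (\<lambda>xs. P xs \<and> Q xs)"
proof -
  assume "decidable k P" "decidable k Q"
  hence "total_rec k (\<lambda>xs. (if P xs then 1 else 0) * (if Q xs then 1 else 0))"
    unfolding decidable_def by (intro total_rec_mult)
  thus ?thesis unfolding decidable_def by (rule total_rec_cong) auto
qed

lemma decidable_imp: "decidable k P \<Longrightarrow> decidable k Q \<Longrightarrow> decidable k (\<lambda>xs. P xs \<longrightarrow> Q xs)"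
  using decidable_not[OF decidable_conj[OF _ decidable_not], of k P Q] by simp

lemma decidable_const: "decidable k (\<lambda>xs. b)"
  unfolding decidable_def by (rule total_rec_const)

lemma decidable_less:
  assumes "total_rec k f" "total_rec k g"
  shows "decidable k (\<lambda>xs. f xs < g xs)"
proof -
  \<comment> \<open>The truncated difference is positive exactly if \<open>f xs < g xs\<close>;
    subtracting twice from 1 normalises a positive value to 1 and keeps 0.\<close>
  have "total_rec k (\<lambda>xs. 1 - (1 - (g xs - f xs)))"
    using assms by (intro total_rec_diff total_rec_const)
  thus ?thesis unfolding decidable_def by (rule total_rec_cong) auto
qed

lemma decidable_eq:
  assumes "total_rec k f" "total_rec k g"
  shows "decidable k (\<lambda>xs. f xs = g xs)"
proof -
  have "decidable k (\<lambda>xs. \<not> f xs < g xs \<and> \<not> g xs < f xs)"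
    using assms by (intro decidable_not decidable_conj decidable_less)
  thus ?thesis by (rule decidable_cong) auto
qed

lemma total_rec_if:
  assumes "decidable k P" "total_rec k f" "total_rec k g"
  shows "total_rec k (\<lambda>xs. if P xs then f xs else g xs)"
proof -
  have "total_rec k (\<lambda>xs. (if P xs then 1 else 0) * f xs + (if \<not> P xs then 1 else 0) * g xs)"
    using assms decidable_not[OF assms(1)] unfolding decidable_def
    by (intro total_rec_add total_rec_mult)
  thus ?thesis by (rule total_rec_cong) auto
qed

lemma decidable_mem:
  assumes "computable_set S" "total_rec k f"
  shows "decidable k (\<lambda>xs. f xs \<in> S)"
proof -
  obtain r where r: "\<And>x. rf_eval r [x] = Some (if x \<in> S then 1 else 0)"
    using assms(1) unfolding computable_set_def partial_computable_def by metis
  have "total_rec 1 (\<lambda>xs. if xs ! 0 \<in> S then 1 else 0)"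
    unfolding total_rec_def by (intro exI[of _ r]) (auto simp: r length_Suc_conv)
  from total_rec_comp1[OF this assms(2)] show ?thesis unfolding decidable_def by simp
qed

section \<open>Unbounded search and unpairing\<close>

lemma total_rec_Least:
  assumes "decidable (Suc k) P" "\<And>xs. length xs = k \<Longrightarrow> \<exists>n. P (n # xs)"
  shows "total_rec k (\<lambda>xs. LEAST n. P (n # xs))"
proof -
  \<comment> \<open>\<open>Mu\<close> looks for a zero, so the search runs on the indicator of the
    negation. This indicator is total, hence all values below the root are defined, as
    \<open>Mu\<close> requires.\<close>
  obtain r where r: "\<And>xs. length xs = Suc k \<Longrightarrow> rf_eval r xs = Some (if \<not> P xs then 1 else 0)"
    using decidable_not[OF assms(1)] unfolding decidable_def total_rec_def by auto
  have "rf_eval (Mu r) xs = Some (LEAST n. P (n # xs))" if "length xs = k" for xs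
  proof -
    define root where "root n \<longleftrightarrow> rf_eval r (n # xs) = Some 0
                      \<and> (\<forall>m<n. \<exists>y. rf_eval r (m # xs) = Some (Suc y))" for n
    have root: "root n \<longleftrightarrow> P (n # xs) \<and> (\<forall>m<n. \<not> P (m # xs))" for n
      using that unfolding root_def by (auto simp: r)
    define N where "N = (LEAST n. P (n # xs))"
    have "root N" unfolding root N_def
      using LeastI_ex[OF assms(2)[OF that]] by (auto dest: not_less_Least)
    moreover have "root n \<Longrightarrow> n = N" for n
      using \<open>root N\<close> unfolding root by (metis nat_neq_iff)
    ultimately have "(THE n. root n) = N"
      by (rule the_equality)
    with \<open>root N\<close> have "(if \<exists>n. root n then Some (THE n. root n) else None) = Some N"
      by metis
    thus ?thesis unfolding N_def root_def by (simp add: Let_def)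
  qed
  thus ?thesis unfolding total_rec_def by blast
qed

text \<open>A code \<open>triangle (a + b) + a\<close> lies in the interval from
  \<open>triangle (a + b)\<close> up to, but excluding, \<open>triangle (Suc (a + b))\<close>. So
  \<open>a + b\<close> is found by a least-number search, and both components follow by
  subtraction.\<close>

lemma prod_decode_components:
  defines "s \<equiv> \<lambda>n. LEAST k. n < triangle (Suc k)"
  shows "fst (prod_decode n) = n - triangle (s n)" "snd (prod_decode n) = s n - (n - triangle (s n))"
proof -
  obtain a b where n: "n = prod_encode (a, b)" by (metis prod_decode_inverse surj_pair)
  have mono: "triangle i \<le> triangle j" if "i \<le> j" for i j
    using that by (induction rule: dec_induct) auto
  have "s n = a + b"
    unfolding s_def
  proof (rule Least_equality)
    show "n < triangle (Suc (a + b))" by (simp add: n prod_encode_def)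
    fix k assume "n < triangle (Suc k)"
    \<comment> \<open>Otherwise \<open>Suc k \<le> a + b\<close>, and monotonicity would give
      \<open>triangle (Suc k) \<le> n\<close>.\<close>
    thus "a + b \<le> k" using mono[of "Suc k" "a + b"] by (force simp: n prod_encode_def)
  qed
  thus "fst (prod_decode n) = n - triangle (s n)" "snd (prod_decode n) = s n - (n - triangle (s n))"
    using n by (simp_all add: prod_encode_inverse) (simp_all add: prod_encode_def)
qed

lemma total_rec_prod_decode:
  assumes "total_rec k f"
  shows "total_rec k (\<lambda>xs. fst (prod_decode (f xs)))" "total_rec k (\<lambda>xs. snd (prod_decode (f xs)))"
proof -
  have "total_rec 1 (\<lambda>xs. LEAST n. (n # xs) ! 1 < triangle (Suc ((n # xs) ! 0)))"
  proof (rule total_rec_Least)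
    show "decidable (Suc 1) (\<lambda>ys. ys ! 1 < triangle (Suc (ys ! 0)))"
      by (intro decidable_less total_rec_triangle total_rec_Suc total_rec_proj) auto
    show "\<exists>n. (n # xs) ! 1 < triangle (Suc ((n # xs) ! 0))" if "length xs = 1" for xs
      \<comment> \<open>The argument itself bounds the search, since n <
        \<open>triangle (Suc n)\<close>.\<close>
      by (intro exI[of _ "xs ! 0"]) (simp del: One_nat_def add: nth_Cons')
  qed
  from total_rec_comp1[OF this assms]
  have s: "total_rec k (\<lambda>xs. LEAST n. f xs < triangle (Suc n))" by simp
  show "total_rec k (\<lambda>xs. fst (prod_decode (f xs)))" "total_rec k (\<lambda>xs. snd (prod_decode (f xs)))"
    unfolding prod_decode_components
    by (intro total_rec_diff total_rec_triangle s assms)+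
qed

section \<open>Partial computable functions and their fibers\<close>

lemma partial_computable_const: "partial_computable (\<lambda>_. Some c)"
  using total_rec_1D[OF total_rec_const] unfolding partial_computable_def by metis

lemma partial_computable_total: "total_rec 1 f \<Longrightarrow> partial_computable (\<lambda>i. Some (f [i]))"
  using total_rec_1D unfolding partial_computable_def by metis

lemma partial_computable_map_option:
  assumes "total_rec 1 f" "partial_computable \<phi>"
  shows "partial_computable (\<lambda>i. map_option (\<lambda>a. f [a]) (\<phi> i))"
proof -
  obtain r s where r: "\<And>x. rf_eval r [x] = Some (f [x])" and s: "\<And>x. rf_eval s [x] = \<phi> x"
    using total_rec_1D[OF assms(1)] assms(2) unfolding partial_computable_def by metis
  have "rf_eval (Comp r [s]) [x] = map_option (\<lambda>a. f [a]) (\<phi> x)" for x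
    by (cases "\<phi> x") (auto simp: Let_def s r)
  thus ?thesis unfolding partial_computable_def by metis
qed

lemma partial_computable_pointwise:
  assumes "total_rec 2 f" "partial_computable \<phi>" "partial_computable \<psi>"
  shows "partial_computable (pointwise (\<lambda>a b. f [a, b]) \<phi> \<psi>)"
proof -
  obtain r where r: "\<And>x y. rf_eval r [x, y] = Some (f [x, y])"
    using total_rec_2D[OF assms(1)] by metis
  obtain s t where s: "\<And>x. rf_eval s [x] = \<phi> x" "\<And>x. rf_eval t [x] = \<psi> x"
    using assms unfolding partial_computable_def by metis
  have "rf_eval (Comp r [s, t]) [x] = pointwise (\<lambda>a b. f [a, b]) \<phi> \<psi> x" for x
    by (cases "\<phi> x"; cases "\<psi> x") (auto simp: Let_def s r pointwise_def)
  thus ?thesis unfolding partial_computable_def by metis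
qed

lemma ce_set_fiber:
  assumes "partial_computable \<phi>"
  shows "ce_set {i. \<phi> i = Some a}"
proof -
  have "total_rec 1 (\<lambda>xs. if xs ! 0 = a then 0 else 1)"
    by (intro total_rec_if decidable_eq total_rec_proj total_rec_const) simp
  from total_rec_1D[OF this] obtain r where r: "\<And>x. rf_eval r [x] = Some (if x = a then 0 else 1)"
    by auto
  obtain s where s: "\<And>x. rf_eval s [x] = \<phi> x"
    using assms unfolding partial_computable_def by metis
  \<comment> \<open>\<open>Proj 1\<close> skips the search variable, so \<open>t\<close> does not
    depend on it. \<open>Mu t\<close> therefore stops at once if \<open>\<phi> x = Some a\<close>,
    and has no root if \<open>\<phi> x\<close> is undefined or has another value.\<close>
  define t where "t = Comp r [Comp s [Proj 1]]"
  have t: "rf_eval t [n, x] = map_option (\<lambda>y. if y = a then 0 else 1) (\<phi> x)" for n x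
    unfolding t_def by (cases "\<phi> x") (auto simp: Let_def s r)
  have "dom (\<lambda>x. rf_eval (Mu t) [x]) = {i. \<phi> i = Some a}"
    by (auto simp: t Let_def dom_def split: if_splits)
  thus ?thesis unfolding ce_set_def partial_computable_def by metis
qed

section \<open>Cohesive powers of computable fields\<close>

text \<open>The tags 0 to 4 separate the constructors. Injectivity allows membership of a code in
  the diagram to be read as truth of the coded equation.\<close>

lemma term_code_inject: "term_code s = term_code t \<Longrightarrow> s = t"
proof (induction s arbitrary: t)
  case (Elem a) thus ?case by (cases t) auto
next
  case TZero thus ?case by (cases t) auto
next
  case TOne thus ?case by (cases t) auto
next
  case (TAdd s1 s2) thus ?case by (cases t) auto
next
  case (TMult s1 s2) thus ?case by (cases t) auto
qed

lemma atomic_diagram_iff: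
  "prod_encode (term_code s, term_code t) \<in> atomic_diagram R \<longleftrightarrow>
     term_elems s \<subseteq> carrier R \<and> term_elems t \<subseteq> carrier R \<and> term_val R s = term_val R t"
  unfolding atomic_diagram_def by (auto dest!: term_code_inject)

text \<open>The value \<open>f a b\<close> is the only c for which the equation between
  \<open>T a b\<close> and \<open>Elem c\<close> belongs to the decidable atomic diagram, so a
  search through the diagram computes it. In \<open>code\<close> the operands sit at positions 1 and
  2 because position 0 holds the candidate c.\<close>

lemma total_rec_binary_op:
  fixes R :: "nat ring"
  assumes "computable_set (carrier R)" "computable_set (atomic_diagram R)"
    and val: "\<And>a b. term_val R (T a b) = f a b"
    and elems: "\<And>a b. term_elems (T a b) = {a, b}"
    and code: "total_rec 3 (\<lambda>xs. term_code (T (xs ! 1) (xs ! 2)))"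
    and closed: "\<And>a b. a \<in> carrier R \<Longrightarrow> b \<in> carrier R \<Longrightarrow> f a b \<in> carrier R"
  shows "\<exists>g. total_rec 2 g \<and> (\<forall>a\<in>carrier R. \<forall>b\<in>carrier R. g [a, b] = f a b)"
proof -
  \<comment> \<open>The implications make \<open>P\<close> true when an operand is outside the
    carrier. The search then stops at 0, and the resulting function is total.\<close>
  define P where "P xs \<longleftrightarrow> (xs ! 1 \<in> carrier R \<longrightarrow> xs ! 2 \<in> carrier R \<longrightarrow>
    prod_encode (term_code (T (xs ! 1) (xs ! 2)), prod_encode (0, xs ! 0)) \<in> atomic_diagram R)" for xs
  have P: "P [c, a, b] \<longleftrightarrow> c = f a b" if "a \<in> carrier R" "b \<in> carrier R" for a b c
    using atomic_diagram_iff[of "T a b" "Elem c" R] that closed[OF that]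
    by (auto simp: P_def val elems)
  have "decidable 3 P" unfolding P_def
    by (intro decidable_imp decidable_mem total_rec_prod_encode total_rec_proj total_rec_const assms)
      simp_all
  moreover have "\<exists>n. P (n # xs)" if "length xs = 2" for xs
  proof -
    from that have "length xs = Suc (Suc 0)" by simp
    then obtain a b where xs: "xs = [a, b]" unfolding length_Suc_conv by auto
    show ?thesis unfolding xs by (cases "a \<in> carrier R \<and> b \<in> carrier R") (auto simp: P, auto simp: P_def)
  qed
  ultimately have "total_rec 2 (\<lambda>xs. LEAST n. P (n # xs))"
    by (intro total_rec_Least) (simp_all add: numeral_eq_Suc)
  moreover have "(LEAST n. P [n, a, b]) = f a b" if "a \<in> carrier R" "b \<in> carrier R" for a b
    by (auto simp: P that intro: Least_equality)
  ultimately show ?thesis by blast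
qed

lemma total_rec_field_add:
  assumes "computable_field R"
  shows "\<exists>g. total_rec 2 g \<and> (\<forall>a\<in>carrier R. \<forall>b\<in>carrier R. g [a, b] = a \<oplus>\<^bsub>R\<^esub> b)"
proof -
  interpret field R using assms unfolding computable_field_def by blast
  show ?thesis
  proof (rule total_rec_binary_op)
    show "total_rec 3 (\<lambda>xs. term_code (TAdd (Elem (xs ! 1)) (Elem (xs ! 2))))"
      by (simp, intro total_rec_prod_encode total_rec_proj total_rec_const; simp)
  qed (use assms in \<open>auto simp: computable_field_def\<close>)
qed

lemma total_rec_field_mult:
  assumes "computable_field R"
  shows "\<exists>g. total_rec 2 g \<and> (\<forall>a\<in>carrier R. \<forall>b\<in>carrier R. g [a, b] = a \<otimes>\<^bsub>R\<^esub> b)"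
proof -
  interpret field R using assms unfolding computable_field_def by blast
  show ?thesis
  proof (rule total_rec_binary_op)
    show "total_rec 3 (\<lambda>xs. term_code (TMult (Elem (xs ! 1)) (Elem (xs ! 2))))"
      by (simp, intro total_rec_prod_encode total_rec_proj total_rec_const; simp)
  qed (use assms in \<open>auto simp: computable_field_def\<close>)
qed

section \<open>Statements that hold almost everywhere along the cohesive set\<close>

definition along :: "nat set \<Rightarrow> nat filter" where
  "along C = inf cofinite (principal C)"

text \<open>This recasts almost inclusion as a filter statement, so that finitely many such
  conditions are combined by \<open>eventually_elim\<close> instead of by unions of finite
  exceptional sets.\<close>

lemma almost_subset_iff_eventually: "C \<subseteq>\<^sup>* S \<longleftrightarrow> (\<forall>\<^sub>F i in along C. i \<in> S)"
proof -
  have "C - S = {i. \<not> (i \<in> C \<longrightarrow> i \<in> S)}" by auto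
  thus ?thesis unfolding almost_subset_def along_def
    by (simp add: eventually_inf_principal eventually_cofinite)
qed

lemma along_neq_bot:
  assumes "infinite C"
  shows "along C \<noteq> bot"
  using assms unfolding along_def trivial_limit_def
  by (simp add: eventually_inf_principal eventually_cofinite)

lemma eventually_along_ge: "\<forall>\<^sub>F i in along C. n \<le> i"
proof -
  have "finite {i. \<not> (i \<in> C \<longrightarrow> n \<le> i)}" by (rule finite_subset[of _ "{..<n}"]) auto
  thus ?thesis unfolding along_def by (simp add: eventually_inf_principal eventually_cofinite)
qed

text \<open>The fiber over a is c.e., so the c.e. clause of cohesiveness decides it: almost all of C
  lies inside it, or almost all of C lies outside.\<close>

lemma cohesive_fiber:
  assumes "cohesive C" "partial_computable \<phi>"
  shows "(\<forall>\<^sub>F i in along C. \<phi> i = Some a) \<or> (\<forall>\<^sub>F i in along C. \<phi> i \<noteq> Some a)"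
  using assms ce_set_fiber[OF assms(2), of a] unfolding cohesive_def almost_subset_iff_eventually
  by fastforce

section \<open>The power of a computable field as an integral domain\<close>

locale cohesive_power_field = field R for R :: "nat ring" (structure) +
  fixes C :: "nat set"
  assumes computable: "computable_field R" and cohesive: "cohesive C"
begin

abbreviation "funs \<equiv> cohesive_funs C R"
abbreviation "cls \<equiv> cohesive_class C R"
abbreviation "P \<equiv> cohesive_power C R"

lemma along_nontrivial: "along C \<noteq> bot"
  using cohesive along_neq_bot unfolding cohesive_def by blast

lemma funs_defined: "\<phi> \<in> funs \<Longrightarrow> \<forall>\<^sub>F i in along C. \<exists>a\<in>carrier R. \<phi> i = Some a"
  unfolding cohesive_funs_def almost_subset_iff_eventually
  by (auto elim!: eventually_mono simp: ran_def)

text \<open>The definedness demanded by \<open>cohesive_eq\<close> comes for free on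
  \<open>funs\<close>, so equality of option values along C suffices.\<close>

lemma cls_eq_iff:
  assumes "\<phi> \<in> funs" "\<psi> \<in> funs"
  shows "cls \<phi> = cls \<psi> \<longleftrightarrow> (\<forall>\<^sub>F i in along C. \<phi> i = \<psi> i)"
proof -
  have "cls \<phi> = cls \<psi> \<longleftrightarrow> (\<phi>, \<psi>) \<in> cohesive_eq C R"
    using eq_equiv_class_iff[OF equiv_cohesive_eq assms] by simp
  also have "\<dots> \<longleftrightarrow> (\<forall>\<^sub>F i in along C. \<phi> i \<noteq> None \<and> \<phi> i = \<psi> i)"
    using assms by (simp add: cohesive_eq_def almost_subset_iff_eventually)
  also have "\<dots> \<longleftrightarrow> (\<forall>\<^sub>F i in along C. \<phi> i = \<psi> i)"
    using funs_defined[OF assms(1)] by (auto elim: eventually_elim2)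
  finally show ?thesis .
qed

lemma const_in_funs: "a \<in> carrier R \<Longrightarrow> (\<lambda>_. Some a) \<in> funs"
  unfolding cohesive_funs_def almost_subset_iff_eventually
  by (auto simp: partial_computable_const ran_def)

lemma carrier_power: "carrier P = cls ` funs"
  by (auto simp: cohesive_power_def quotient_def)

lemma cls_in_carrier: "\<phi> \<in> funs \<Longrightarrow> cls \<phi> \<in> carrier P"
  by (simp add: carrier_power)

lemma power_zero: "\<zero>\<^bsub>P\<^esub> = cls (\<lambda>_. Some \<zero>)" and power_one: "\<one>\<^bsub>P\<^esub> = cls (\<lambda>_. Some \<one>)"
  by (simp_all add: cohesive_power_def)

text \<open>The operation has to be computable only on the carrier: the ranges of \<phi> and \<psi>
  lie there, so replacing f by its total realizer g leaves the pointwise function unchanged, also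
  where it is undefined.\<close>

lemma pointwise_in_funs:
  assumes g: "total_rec 2 g" "\<And>a b. a \<in> carrier R \<Longrightarrow> b \<in> carrier R \<Longrightarrow> g [a, b] = f a b"
    and closed: "\<And>a b. a \<in> carrier R \<Longrightarrow> b \<in> carrier R \<Longrightarrow> f a b \<in> carrier R"
    and funs: "\<phi> \<in> funs" "\<psi> \<in> funs"
  shows "pointwise f \<phi> \<psi> \<in> funs"
proof -
  have ran: "\<phi> i = Some a \<Longrightarrow> a \<in> carrier R" "\<psi> i = Some a \<Longrightarrow> a \<in> carrier R" for i a
    using funs by (auto simp: cohesive_funs_def ran_def)
  have eq: "pointwise f \<phi> \<psi> = pointwise (\<lambda>a b. g [a, b]) \<phi> \<psi>"
  proof
    show "pointwise f \<phi> \<psi> i = pointwise (\<lambda>a b. g [a, b]) \<phi> \<psi> i" for i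
      by (cases "\<phi> i"; cases "\<psi> i") (auto simp: pointwise_def g(2) ran)
  qed
  have "partial_computable (pointwise f \<phi> \<psi>)"
    unfolding eq using funs by (intro partial_computable_pointwise g) (auto simp: cohesive_funs_def)
  moreover have "ran (pointwise f \<phi> \<psi>) \<subseteq> carrier R"
    by (auto simp: ran_def pointwise_def bind_eq_Some_conv intro!: closed dest: ran)
  moreover have "\<forall>\<^sub>F i in along C. i \<in> dom (pointwise f \<phi> \<psi>)"
    using funs_defined[OF funs(1)] funs_defined[OF funs(2)]
    by eventually_elim (auto simp: pointwise_def)
  ultimately show ?thesis by (simp add: cohesive_funs_def almost_subset_iff_eventually)
qed

text \<open>Well-definedness on classes: changing representatives alters the pointwise result only
  on a finite part of C, so all united classes coincide.\<close>

lemma UN_cls_pointwise: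
  assumes closed: "\<And>\<phi> \<psi>. \<phi> \<in> funs \<Longrightarrow> \<psi> \<in> funs \<Longrightarrow> pointwise f \<phi> \<psi> \<in> funs"
    and funs: "\<phi> \<in> funs" "\<psi> \<in> funs"
  shows "(\<Union>\<phi>\<in>cls \<phi>. \<Union>\<psi>\<in>cls \<psi>. cls (pointwise f \<phi> \<psi>)) = cls (pointwise f \<phi> \<psi>)"
proof (rule UN_equiv_class2[OF equiv_cohesive_eq equiv_cohesive_eq _ funs])
  show "congruent2 (cohesive_eq C R) (cohesive_eq C R) (\<lambda>\<phi> \<psi>. cls (pointwise f \<phi> \<psi>))"
  proof (rule congruent2I')
    fix \<phi> \<phi>' \<psi> \<psi>' assume "(\<phi>, \<phi>') \<in> cohesive_eq C R" "(\<psi>, \<psi>') \<in> cohesive_eq C R"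
    hence funs: "\<phi> \<in> funs" "\<phi>' \<in> funs" "\<psi> \<in> funs" "\<psi>' \<in> funs"
      and eq: "\<forall>\<^sub>F i in along C. \<phi> i \<noteq> None \<and> \<phi> i = \<phi>' i" "\<forall>\<^sub>F i in along C. \<psi> i \<noteq> None \<and> \<psi> i = \<psi>' i"
      by (auto simp: cohesive_eq_def almost_subset_iff_eventually)
    have "\<forall>\<^sub>F i in along C. pointwise f \<phi> \<psi> i = pointwise f \<phi>' \<psi>' i"
      using eq by eventually_elim (simp add: pointwise_def)
    thus "cls (pointwise f \<phi> \<psi>) = cls (pointwise f \<phi>' \<psi>')"
      by (simp add: cls_eq_iff closed funs)
  qed
qed

lemma pointwise_add_in_funs: "\<phi> \<in> funs \<Longrightarrow> \<psi> \<in> funs \<Longrightarrow> pointwise (\<oplus>) \<phi> \<psi> \<in> funs"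
  and pointwise_mult_in_funs: "\<phi> \<in> funs \<Longrightarrow> \<psi> \<in> funs \<Longrightarrow> pointwise (\<otimes>) \<phi> \<psi> \<in> funs"
  using total_rec_field_add[OF computable] total_rec_field_mult[OF computable]
  by (auto intro: pointwise_in_funs)

lemma power_add:
  "\<phi> \<in> funs \<Longrightarrow> \<psi> \<in> funs \<Longrightarrow> cls \<phi> \<oplus>\<^bsub>P\<^esub> cls \<psi> = cls (pointwise (\<oplus>) \<phi> \<psi>)"
  using UN_cls_pointwise[OF pointwise_add_in_funs] by (simp add: cohesive_power_def)

lemma power_mult:
  "\<phi> \<in> funs \<Longrightarrow> \<psi> \<in> funs \<Longrightarrow> cls \<phi> \<otimes>\<^bsub>P\<^esub> cls \<psi> = cls (pointwise (\<otimes>) \<phi> \<psi>)"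
  using UN_cls_pointwise[OF pointwise_mult_in_funs] by (simp add: cohesive_power_def)

text \<open>Negation is expressed as multiplication by the constant function -1, so its
  computability reduces to that of multiplication.\<close>

lemma additive_inverse_in_funs:
  assumes "\<phi> \<in> funs"
  shows "pointwise (\<otimes>) (\<lambda>_. Some (\<ominus> \<one>)) \<phi> \<in> funs"
  by (intro pointwise_mult_in_funs const_in_funs assms) auto

lemmas power_simps = power_add power_mult power_zero power_one const_in_funs cls_in_carrier
  pointwise_add_in_funs pointwise_mult_in_funs cls_eq_iff

text \<open>Every equational axiom is inherited from \<open>R\<close>: its two sides agree at each
  index at which the representatives involved are defined.\<close>

lemma cring_power: "cring P"
proof (rule cringI)
  show "abelian_group P"
  proof (rule abelian_groupI)
    fix x assume "x \<in> carrier P"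
    then obtain \<phi> where \<phi>: "\<phi> \<in> funs" "x = cls \<phi>" by (auto simp: carrier_power)
    have "\<forall>\<^sub>F i in along C. pointwise (\<oplus>) (\<lambda>_. Some \<zero>) \<phi> i = \<phi> i"
      using funs_defined[OF \<phi>(1)] by eventually_elim (auto simp: pointwise_def)
    thus "\<zero>\<^bsub>P\<^esub> \<oplus>\<^bsub>P\<^esub> x = x" using \<phi> by (simp add: power_simps)
    have "\<forall>\<^sub>F i in along C. pointwise (\<oplus>) (pointwise (\<otimes>) (\<lambda>_. Some (\<ominus> \<one>)) \<phi>) \<phi> i = Some \<zero>"
      using funs_defined[OF \<phi>(1)] by eventually_elim (auto simp: pointwise_def l_minus l_neg)
    hence "cls (pointwise (\<otimes>) (\<lambda>_. Some (\<ominus> \<one>)) \<phi>) \<oplus>\<^bsub>P\<^esub> x = \<zero>\<^bsub>P\<^esub>"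
      using \<phi> additive_inverse_in_funs[OF \<phi>(1)] by (simp add: power_simps)
    thus "\<exists>y\<in>carrier P. y \<oplus>\<^bsub>P\<^esub> x = \<zero>\<^bsub>P\<^esub>"
      using additive_inverse_in_funs[OF \<phi>(1)] cls_in_carrier by blast
    fix y assume "y \<in> carrier P"
    then obtain \<psi> where \<psi>: "\<psi> \<in> funs" "y = cls \<psi>" by (auto simp: carrier_power)
    show "x \<oplus>\<^bsub>P\<^esub> y \<in> carrier P" using \<phi> \<psi> by (simp add: power_simps)
    have "\<forall>\<^sub>F i in along C. pointwise (\<oplus>) \<phi> \<psi> i = pointwise (\<oplus>) \<psi> \<phi> i"
      using funs_defined[OF \<phi>(1)] funs_defined[OF \<psi>(1)]
      by eventually_elim (auto simp: pointwise_def a_comm)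
    thus "x \<oplus>\<^bsub>P\<^esub> y = y \<oplus>\<^bsub>P\<^esub> x"
      using \<phi> \<psi> by (simp add: power_simps)
    fix z assume "z \<in> carrier P"
    then obtain \<chi> where \<chi>: "\<chi> \<in> funs" "z = cls \<chi>" by (auto simp: carrier_power)
    have "\<forall>\<^sub>F i in along C. pointwise (\<oplus>) (pointwise (\<oplus>) \<phi> \<psi>) \<chi> i = pointwise (\<oplus>) \<phi> (pointwise (\<oplus>) \<psi> \<chi>) i"
      using funs_defined[OF \<phi>(1)] funs_defined[OF \<psi>(1)] funs_defined[OF \<chi>(1)]
      by eventually_elim (auto simp: pointwise_def a_assoc)
    thus "x \<oplus>\<^bsub>P\<^esub> y \<oplus>\<^bsub>P\<^esub> z = x \<oplus>\<^bsub>P\<^esub> (y \<oplus>\<^bsub>P\<^esub> z)"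
      using \<phi> \<psi> \<chi> by (simp add: power_simps)
  qed (simp add: power_simps)
  show "comm_monoid P"
  proof (rule comm_monoidI)
    fix x assume "x \<in> carrier P"
    then obtain \<phi> where \<phi>: "\<phi> \<in> funs" "x = cls \<phi>" by (auto simp: carrier_power)
    have "\<forall>\<^sub>F i in along C. pointwise (\<otimes>) (\<lambda>_. Some \<one>) \<phi> i = \<phi> i"
      using funs_defined[OF \<phi>(1)] by eventually_elim (auto simp: pointwise_def)
    thus "\<one>\<^bsub>P\<^esub> \<otimes>\<^bsub>P\<^esub> x = x" using \<phi> by (simp add: power_simps)
    fix y assume "y \<in> carrier P"
    then obtain \<psi> where \<psi>: "\<psi> \<in> funs" "y = cls \<psi>" by (auto simp: carrier_power)
    show "x \<otimes>\<^bsub>P\<^esub> y \<in> carrier P" using \<phi> \<psi> by (simp add: power_simps)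
    have "\<forall>\<^sub>F i in along C. pointwise (\<otimes>) \<phi> \<psi> i = pointwise (\<otimes>) \<psi> \<phi> i"
      using funs_defined[OF \<phi>(1)] funs_defined[OF \<psi>(1)]
      by eventually_elim (auto simp: pointwise_def m_comm)
    thus "x \<otimes>\<^bsub>P\<^esub> y = y \<otimes>\<^bsub>P\<^esub> x"
      using \<phi> \<psi> by (simp add: power_simps)
    fix z assume "z \<in> carrier P"
    then obtain \<chi> where \<chi>: "\<chi> \<in> funs" "z = cls \<chi>" by (auto simp: carrier_power)
    have "\<forall>\<^sub>F i in along C. pointwise (\<otimes>) (pointwise (\<otimes>) \<phi> \<psi>) \<chi> i = pointwise (\<otimes>) \<phi> (pointwise (\<otimes>) \<psi> \<chi>) i"
      using funs_defined[OF \<phi>(1)] funs_defined[OF \<psi>(1)] funs_defined[OF \<chi>(1)]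
      by eventually_elim (auto simp: pointwise_def m_assoc)
    thus "x \<otimes>\<^bsub>P\<^esub> y \<otimes>\<^bsub>P\<^esub> z = x \<otimes>\<^bsub>P\<^esub> (y \<otimes>\<^bsub>P\<^esub> z)"
      using \<phi> \<psi> \<chi> by (simp add: power_simps)
  qed (simp add: power_simps)
  fix x y z assume "x \<in> carrier P" "y \<in> carrier P" "z \<in> carrier P"
  then obtain \<phi> \<psi> \<chi> where *: "\<phi> \<in> funs" "x = cls \<phi>" "\<psi> \<in> funs" "y = cls \<psi>" "\<chi> \<in> funs" "z = cls \<chi>"
    by (auto simp: carrier_power)
  have "\<forall>\<^sub>F i in along C. pointwise (\<otimes>) (pointwise (\<oplus>) \<phi> \<psi>) \<chi> i
      = pointwise (\<oplus>) (pointwise (\<otimes>) \<phi> \<chi>) (pointwise (\<otimes>) \<psi> \<chi>) i"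
    using funs_defined[OF *(1)] funs_defined[OF *(3)] funs_defined[OF *(5)]
    by eventually_elim (auto simp: pointwise_def l_distr)
  thus "(x \<oplus>\<^bsub>P\<^esub> y) \<otimes>\<^bsub>P\<^esub> z = x \<otimes>\<^bsub>P\<^esub> z \<oplus>\<^bsub>P\<^esub> y \<otimes>\<^bsub>P\<^esub> z"
    using * by (simp add: power_simps)
qed

lemma cls_eq_zero_iff: "\<phi> \<in> funs \<Longrightarrow> cls \<phi> = \<zero>\<^bsub>P\<^esub> \<longleftrightarrow> (\<forall>\<^sub>F i in along C. \<phi> i = Some \<zero>)"
  by (simp add: power_simps)

lemma domain_power: "domain P"
proof (rule domain.intro[OF cring_power domain_axioms.intro])
  show "\<one>\<^bsub>P\<^esub> \<noteq> \<zero>\<^bsub>P\<^esub>" using along_nontrivial by (simp add: power_simps)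
  fix x y assume 0: "x \<otimes>\<^bsub>P\<^esub> y = \<zero>\<^bsub>P\<^esub>" and "x \<in> carrier P" "y \<in> carrier P"
  then obtain \<phi> \<psi> where *: "\<phi> \<in> funs" "x = cls \<phi>" "\<psi> \<in> funs" "y = cls \<psi>"
    by (auto simp: carrier_power)
  have ev: "\<forall>\<^sub>F i in along C. pointwise (\<otimes>) \<phi> \<psi> i = Some \<zero>"
    using 0 * by (simp add: power_simps)
  have "\<forall>\<^sub>F i in along C. \<phi> i = Some \<zero> \<or> \<psi> i = Some \<zero>"
    using ev funs_defined[OF *(1)] funs_defined[OF *(3)]
    by eventually_elim (auto simp: pointwise_def integral_iff)
  moreover have "partial_computable \<phi>" using * by (simp add: cohesive_funs_def)
  \<comment> \<open>A disjunction that holds almost everywhere need not split in general. Here the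
    fiber of \<phi> over 0 is decided along C, and if \<phi> avoids 0 almost everywhere, then \<psi>
    vanishes almost everywhere.\<close>
  ultimately have "(\<forall>\<^sub>F i in along C. \<phi> i = Some \<zero>) \<or> (\<forall>\<^sub>F i in along C. \<psi> i = Some \<zero>)"
    using cohesive_fiber[OF cohesive, of \<phi> \<zero>]
      eventually_elim2[of _ "along C" "\<lambda>i. \<phi> i \<noteq> Some \<zero>" "\<lambda>i. \<psi> i = Some \<zero>"] by blast
  thus "x = \<zero>\<^bsub>P\<^esub> \<or> y = \<zero>\<^bsub>P\<^esub>" using * by (simp add: cls_eq_zero_iff)
qed

section \<open>Transfer of polynomial evaluation between the power and the field\<close>

lemma power_nat_pow:
  assumes "\<phi> \<in> funs"
  shows "\<exists>\<psi>\<in>funs. cls \<phi> [^]\<^bsub>P\<^esub> (n::nat) = cls \<psi> \<and> (\<forall>\<^sub>F i in along C. \<psi> i = Some (the (\<phi> i) [^] n))"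
proof (induction n)
  case 0
  show ?case by (intro bexI[of _ "\<lambda>_. Some \<one>"]) (auto simp: power_simps)
next
  case (Suc n)
  then obtain \<psi> where \<psi>: "\<psi> \<in> funs" "cls \<phi> [^]\<^bsub>P\<^esub> n = cls \<psi>"
    and ev: "\<forall>\<^sub>F i in along C. \<psi> i = Some (the (\<phi> i) [^] n)" by blast
  have "\<forall>\<^sub>F i in along C. pointwise (\<otimes>) \<psi> \<phi> i = Some (the (\<phi> i) [^] Suc n)"
    using ev funs_defined[OF assms] by eventually_elim (auto simp: pointwise_def)
  thus ?case using \<psi> assms by (intro bexI[of _ "pointwise (\<otimes>) \<psi> \<phi>"]) (auto simp: power_simps)
qed

text \<open>Induction on the coefficient list builds a representative of the value out of pointwise
  sums and products. The arbitrary value of \<open>the\<close> at undefined indices affects only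
  finitely many elements of C.\<close>

lemma power_eval:
  assumes "\<phi> \<in> funs" "set fs \<subseteq> funs"
  shows "\<exists>\<psi>\<in>funs. ring.eval P (map cls fs) (cls \<phi>) = cls \<psi>
    \<and> (\<forall>\<^sub>F i in along C. \<psi> i = Some (eval (map (\<lambda>f. the (f i)) fs) (the (\<phi> i))))"
  using assms(2)
proof (induction fs)
  interpret P: cring P by (rule cring_power)
  case Nil
  show ?case by (intro bexI[of _ "\<lambda>_. Some \<zero>"]) (auto simp: power_simps)
next
  interpret P: cring P by (rule cring_power)
  case (Cons f fs)
  then obtain \<psi> where \<psi>: "\<psi> \<in> funs" "ring.eval P (map cls fs) (cls \<phi>) = cls \<psi>"
    and ev: "\<forall>\<^sub>F i in along C. \<psi> i = Some (eval (map (\<lambda>f. the (f i)) fs) (the (\<phi> i)))" by auto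
  obtain \<chi> where \<chi>: "\<chi> \<in> funs" "cls \<phi> [^]\<^bsub>P\<^esub> length fs = cls \<chi>"
    and ev': "\<forall>\<^sub>F i in along C. \<chi> i = Some (the (\<phi> i) [^] length fs)"
    using power_nat_pow[OF assms(1)] by blast
  have f: "f \<in> funs" using Cons by simp
  have "\<forall>\<^sub>F i in along C. pointwise (\<oplus>) (pointwise (\<otimes>) f \<chi>) \<psi> i
     = Some (eval (map (\<lambda>f. the (f i)) (f # fs)) (the (\<phi> i)))"
    using ev ev' funs_defined[OF f] by eventually_elim (auto simp: pointwise_def)
  moreover have "ring.eval P (map cls (f # fs)) (cls \<phi>) = cls (pointwise (\<oplus>) (pointwise (\<otimes>) f \<chi>) \<psi>)"
    using \<psi> \<chi> f by (simp add: power_simps)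
  ultimately show ?case using \<psi> \<chi> f by (blast intro: pointwise_add_in_funs pointwise_mult_in_funs)
qed

text \<open>Both implications of the theorem pass through this transfer: a root in the power is the
  same as a root at almost every index of C.\<close>

lemma power_eval_eq_zero_iff:
  assumes "\<phi> \<in> funs" "set fs \<subseteq> funs"
  shows "ring.eval P (map cls fs) (cls \<phi>) = \<zero>\<^bsub>P\<^esub>
    \<longleftrightarrow> (\<forall>\<^sub>F i in along C. eval (map (\<lambda>f. the (f i)) fs) (the (\<phi> i)) = \<zero>)"
proof -
  obtain \<psi> where \<psi>: "\<psi> \<in> funs" "ring.eval P (map cls fs) (cls \<phi>) = cls \<psi>"
    and ev: "\<forall>\<^sub>F i in along C. \<psi> i = Some (eval (map (\<lambda>f. the (f i)) fs) (the (\<phi> i)))"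
    using power_eval[OF assms] by blast
  show ?thesis unfolding \<psi>(2) cls_eq_zero_iff[OF \<psi>(1)]
    using ev by (auto elim: eventually_elim2)
qed

end

section \<open>Degrees and algebraic elements of cohesive powers\<close>

lemma subset_image_imp_map: "set ys \<subseteq> f ` A \<Longrightarrow> \<exists>xs. ys = map f xs \<and> set xs \<subseteq> A"
proof (induction ys)
  case (Cons y ys)
  then obtain x xs where "y = f x" "x \<in> A" "ys = map f xs" "set xs \<subseteq> A" by auto
  thus ?case by (intro exI[of _ "x # xs"]) auto
qed simp

text \<open>The minimal polynomial divides every polynomial over k that annihilates x. In
  contrapositive form, an annihilating list too short for the degree of x must begin with 0.\<close>

lemma (in domain) degree_Irr_le:
  assumes "subfield k R" "x \<in> carrier R" "(algebraic over k) x"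
    and "set p \<subseteq> k" "p \<noteq> []" "lead_coeff p \<noteq> \<zero>" "eval p x = \<zero>"
  shows "degree (Irr k x) \<le> degree p"
proof -
  have p: "p \<in> carrier (univ_poly R k)"
    using assms by (simp flip: univ_poly_carrier add: polynomial_def)
  show ?thesis
    using pdivides_imp_degree_le[OF subfieldE(1)[OF assms(1)] IrrE(1)[OF assms(1-3)] p assms(5)]
      Irr_minimal[OF assms(1-3) p assms(7)] by blast
qed

text \<open>Lists start with the leading coefficient, so appending zeros multiplies the minimal
  polynomial by a power of x. This brings all annihilators to the same degree d, and a single search
  over d-tuples serves all elements.\<close>

lemma (in domain) monic_annihilator:
  assumes "subfield k R" "x \<in> carrier R" "(algebraic over k) x" "degree (Irr k x) \<le> d"
  shows "\<exists>cs. length cs = d \<and> set cs \<subseteq> k \<and> eval (\<one> # cs) x = \<zero>"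
proof -
  let ?p = "Irr k x" and ?z = "replicate (d - degree (Irr k x)) \<zero>"
  have k: "k \<subseteq> carrier R" "\<zero> \<in> k"
    using subfieldE(3)[OF assms(1)] subringE(2)[OF subfieldE(1)[OF assms(1)]] by auto
  have "?p \<noteq> []"
    using IrrE(2)[OF assms(1-3)] subfieldE(1)[OF assms(1)] IrrE(1)[OF assms(1-3)] pirreducibleE(1) by blast
  moreover have "set ?p \<subseteq> k"
    using IrrE(1)[OF assms(1-3)] by (auto simp flip: univ_poly_carrier simp: polynomial_def)
  ultimately obtain cs where cs: "?p = \<one> # cs" "set cs \<subseteq> k"
    using IrrE(3)[OF assms(1-3)] by (cases ?p) auto
  have z: "eval ?z x = \<zero>" using eval_replicate[of "[]" x] assms(2) by simp
  have "eval (?p @ ?z) x = eval ?p x \<otimes> x [^] length ?z \<oplus> eval ?z x"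
    using \<open>set ?p \<subseteq> k\<close> k assms(2) by (intro eval_append) auto
  also have "\<dots> = \<zero>" using z IrrE(4)[OF assms(1-3)] assms(2) by simp
  finally have "eval (\<one> # (cs @ ?z)) x = \<zero>" using cs by simp
  moreover have "length (cs @ ?z) = d" using assms(4) cs by simp
  moreover have "set (cs @ ?z) \<subseteq> k" using cs k by auto
  ultimately show ?thesis by blast
qed

section \<open>Total extensions and coded tuples\<close>

lemma total_rec_extension:
  assumes "computable_set S" "s \<in> S" "computable_on S f"
  shows "\<exists>g. total_rec 1 g \<and> (\<forall>a\<in>S. g [a] = f a)"
proof -
  obtain r where r: "\<And>x. x \<in> S \<Longrightarrow> rf_eval r [x] = Some (f x)"
    using assms(3) unfolding computable_on_def partial_computable_def by metis
  \<comment> \<open>Arguments outside the decidable set S are redirected to s, where the program for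
    f is known to halt.\<close>
  have "total_rec 1 (\<lambda>xs. if xs ! 0 \<in> S then xs ! 0 else s)"
    by (intro total_rec_if decidable_mem total_rec_proj total_rec_const assms) simp_all
  from total_rec_1D[OF this]
  obtain t where t: "\<And>x. rf_eval t [x] = Some (if x \<in> S then x else s)"
    unfolding nth_Cons_0 by blast
  have "rf_eval (Comp r [t]) [x] = Some (f (if x \<in> S then x else s))" for x
    using assms(2) by (simp add: t r)
  hence "total_rec 1 (\<lambda>xs. f (if hd xs \<in> S then hd xs else s))"
    unfolding total_rec_def by (intro exI[of _ "Comp r [t]"]) (auto simp: length_Suc_conv simp del: rf_eval.simps)
  thus ?thesis by (intro exI conjI) auto
qed

text \<open>For fixed d every number decodes to a list of length d, and the final remainder is
  dropped. A tuple thus has many codes; a search needs only that it has one.\<close>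

primrec decode_tuple :: "nat \<Rightarrow> nat \<Rightarrow> nat list" where
  "decode_tuple 0 n = []"
| "decode_tuple (Suc d) n = fst (prod_decode n) # decode_tuple d (snd (prod_decode n))"

lemma length_decode_tuple [simp]: "length (decode_tuple d n) = d"
  by (induction d arbitrary: n) auto

lemma decode_tuple_surj: "\<exists>n. decode_tuple (length xs) n = xs"
proof (induction xs)
  case (Cons x xs)
  then obtain n where "decode_tuple (length xs) n = xs" by blast
  thus ?case by (intro exI[of _ "prod_encode (x, n)"]) simp
qed simp

text \<open>Both d and j are fixed, so the induction unfolds the decoding into finitely many
  compositions of unpairing functions.\<close>

lemma total_rec_decode_tuple_nth:
  "total_rec k t \<Longrightarrow> j < d \<Longrightarrow> total_rec k (\<lambda>xs. decode_tuple d (t xs) ! j)"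
proof (induction d arbitrary: t j)
  case (Suc d)
  thus ?case by (cases j) (auto intro: total_rec_prod_decode)
qed simp

lemma decidable_decode_tuple_subset:
  "computable_set S \<Longrightarrow> total_rec k t \<Longrightarrow> decidable k (\<lambda>xs. set (decode_tuple d (t xs)) \<subseteq> S)"
  by (induction d arbitrary: t)
    (auto intro!: decidable_const decidable_conj decidable_mem total_rec_prod_decode)

section \<open>The power of \<open>F\<close> as a subring of the power of \<open>K\<close>\<close>

locale computable_extension =
  K: cohesive_power_field K C + F: cohesive_power_field F C for K F :: "nat ring" and C +
  fixes \<Psi> :: "nat \<Rightarrow> nat"
  assumes hom: "\<Psi> \<in> ring_hom F K" and computable_hom: "computable_on (carrier F) \<Psi>"
begin

abbreviation "base \<equiv> \<Psi> ` carrier F"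
abbreviation "emb \<equiv> cohesive_embedding C K \<Psi>"
abbreviation "power_base \<equiv> emb ` carrier F.P"

lemma hom_closed: "a \<in> carrier F \<Longrightarrow> \<Psi> a \<in> carrier K"
  using hom by (auto simp: ring_hom_def)

lemma subfield_base: "subfield base K"
  using ring_hom_ring.img_is_subfield(2)[OF ring_hom_ringI2[OF F.ring_axioms K.ring_axioms hom]
    F.carrier_is_subfield] by simp

lemma total_rec_hom: "\<exists>g. total_rec 1 g \<and> (\<forall>a\<in>carrier F. g [a] = \<Psi> a)"
  using total_rec_extension[OF _ F.zero_closed computable_hom] F.computable
  unfolding computable_field_def by blast

lemma map_option_in_funs:
  assumes "\<alpha> \<in> F.funs"
  shows "map_option \<Psi> \<circ> \<alpha> \<in> K.funs"
proof -
  obtain g where g: "total_rec 1 g" "\<And>a. a \<in> carrier F \<Longrightarrow> g [a] = \<Psi> a"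
    using total_rec_hom by blast
  have ran: "\<alpha> i = Some a \<Longrightarrow> a \<in> carrier F" for i a
    using assms by (auto simp: cohesive_funs_def ran_def)
  have "map_option \<Psi> \<circ> \<alpha> = (\<lambda>i. map_option (\<lambda>a. g [a]) (\<alpha> i))"
  proof
    show "(map_option \<Psi> \<circ> \<alpha>) i = map_option (\<lambda>a. g [a]) (\<alpha> i)" for i
      by (cases "\<alpha> i") (auto simp: g(2) ran)
  qed
  hence "partial_computable (map_option \<Psi> \<circ> \<alpha>)"
    using assms by (auto simp: cohesive_funs_def intro: partial_computable_map_option g)
  thus ?thesis using assms
    by (auto simp: cohesive_funs_def ran_def almost_subset_iff_eventually dom_def intro!: hom_closed ran)
qed

lemma emb_cls:
  assumes "\<alpha> \<in> F.funs"
  shows "emb (F.cls \<alpha>) = K.cls (map_option \<Psi> \<circ> \<alpha>)"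
  unfolding cohesive_embedding_def
proof (rule UN_equiv_class[OF equiv_cohesive_eq congruentI assms])
  fix \<alpha> \<beta> assume "(\<alpha>, \<beta>) \<in> cohesive_eq C F"
  hence *: "\<alpha> \<in> F.funs" "\<beta> \<in> F.funs" "\<forall>\<^sub>F i in along C. \<alpha> i \<noteq> None \<and> \<alpha> i = \<beta> i"
    by (auto simp: cohesive_eq_def almost_subset_iff_eventually)
  show "K.cls (map_option \<Psi> \<circ> \<alpha>) = K.cls (map_option \<Psi> \<circ> \<beta>)"
    unfolding K.cls_eq_iff[OF map_option_in_funs[OF *(1)] map_option_in_funs[OF *(2)]]
    using *(3) by eventually_elim simp
qed

text \<open>\<Psi> respects the operations at each index where both representatives are defined. The
  homomorphism property makes \<open>power_base\<close> a subring, over which polynomials can be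
  formed.\<close>

lemma emb_hom: "emb \<in> ring_hom F.P K.P"
proof (rule ring_hom_memI)
  fix x assume "x \<in> carrier F.P"
  then obtain \<alpha> where \<alpha>: "\<alpha> \<in> F.funs" "x = F.cls \<alpha>" by (auto simp: F.carrier_power)
  show "emb x \<in> carrier K.P"
    unfolding \<alpha>(2) emb_cls[OF \<alpha>(1)] by (intro K.cls_in_carrier map_option_in_funs \<alpha>)
  fix y assume "y \<in> carrier F.P"
  then obtain \<beta> where \<beta>: "\<beta> \<in> F.funs" "y = F.cls \<beta>" by (auto simp: F.carrier_power)
  note \<alpha>' = map_option_in_funs[OF \<alpha>(1)] and \<beta>' = map_option_in_funs[OF \<beta>(1)]
  note defined = F.funs_defined[OF \<alpha>(1)] F.funs_defined[OF \<beta>(1)]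
  have "\<forall>\<^sub>F i in along C. (map_option \<Psi> \<circ> pointwise (\<otimes>\<^bsub>F\<^esub>) \<alpha> \<beta>) i
      = pointwise (\<otimes>\<^bsub>K\<^esub>) (map_option \<Psi> \<circ> \<alpha>) (map_option \<Psi> \<circ> \<beta>) i"
    using defined by eventually_elim (auto simp: pointwise_def ring_hom_mult[OF hom])
  hence "K.cls (map_option \<Psi> \<circ> pointwise (\<otimes>\<^bsub>F\<^esub>) \<alpha> \<beta>)
      = K.cls (pointwise (\<otimes>\<^bsub>K\<^esub>) (map_option \<Psi> \<circ> \<alpha>) (map_option \<Psi> \<circ> \<beta>))"
    using K.cls_eq_iff[OF map_option_in_funs[OF F.pointwise_mult_in_funs[OF \<alpha>(1) \<beta>(1)]]
        K.pointwise_mult_in_funs[OF \<alpha>' \<beta>']] by blast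
  thus "emb (x \<otimes>\<^bsub>F.P\<^esub> y) = emb x \<otimes>\<^bsub>K.P\<^esub> emb y"
    unfolding \<alpha>(2) \<beta>(2) emb_cls[OF \<alpha>(1)] emb_cls[OF \<beta>(1)] F.power_mult[OF \<alpha>(1) \<beta>(1)]
      K.power_mult[OF \<alpha>' \<beta>'] emb_cls[OF F.pointwise_mult_in_funs[OF \<alpha>(1) \<beta>(1)]] .
  have "\<forall>\<^sub>F i in along C. (map_option \<Psi> \<circ> pointwise (\<oplus>\<^bsub>F\<^esub>) \<alpha> \<beta>) i
      = pointwise (\<oplus>\<^bsub>K\<^esub>) (map_option \<Psi> \<circ> \<alpha>) (map_option \<Psi> \<circ> \<beta>) i"
    using defined by eventually_elim (auto simp: pointwise_def ring_hom_add[OF hom])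
  hence "K.cls (map_option \<Psi> \<circ> pointwise (\<oplus>\<^bsub>F\<^esub>) \<alpha> \<beta>)
      = K.cls (pointwise (\<oplus>\<^bsub>K\<^esub>) (map_option \<Psi> \<circ> \<alpha>) (map_option \<Psi> \<circ> \<beta>))"
    using K.cls_eq_iff[OF map_option_in_funs[OF F.pointwise_add_in_funs[OF \<alpha>(1) \<beta>(1)]]
        K.pointwise_add_in_funs[OF \<alpha>' \<beta>']] by blast
  thus "emb (x \<oplus>\<^bsub>F.P\<^esub> y) = emb x \<oplus>\<^bsub>K.P\<^esub> emb y"
    unfolding \<alpha>(2) \<beta>(2) emb_cls[OF \<alpha>(1)] emb_cls[OF \<beta>(1)] F.power_add[OF \<alpha>(1) \<beta>(1)]
      K.power_add[OF \<alpha>' \<beta>'] emb_cls[OF F.pointwise_add_in_funs[OF \<alpha>(1) \<beta>(1)]] .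
next
  have "map_option \<Psi> \<circ> (\<lambda>_. Some \<one>\<^bsub>F\<^esub>) = (\<lambda>_. Some \<one>\<^bsub>K\<^esub>)"
    using ring_hom_one[OF hom] by auto
  thus "emb \<one>\<^bsub>F.P\<^esub> = \<one>\<^bsub>K.P\<^esub>"
    unfolding F.power_one K.power_one emb_cls[OF F.const_in_funs[OF F.one_closed]]
    by (rule arg_cong)
qed

lemma subring_power_base: "subring power_base K.P"
proof -
  interpret FP: domain F.P by (rule F.domain_power)
  interpret KP: domain K.P by (rule K.domain_power)
  show ?thesis
    by (intro ring_hom_ring.img_is_subring[OF ring_hom_ringI2[OF FP.ring_axioms KP.ring_axioms emb_hom]]
      FP.carrier_is_subring)
qed

text \<open>The coefficients of an annihilating polynomial are lifted to representatives over
  \<open>F\<close>. A nonzero leading class means that its representative fails to vanish almost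
  everywhere; the negation stays outside the quantifier, which is all that the later contradiction
  uses.\<close>

lemma power_algebraicE:
  assumes "\<phi> \<in> K.funs" "(ring.algebraic K.P over power_base) (K.cls \<phi>)"
  obtains \<alpha>s where "set \<alpha>s \<subseteq> F.funs" "\<alpha>s \<noteq> []"
    "\<not> (\<forall>\<^sub>F i in along C. (map_option \<Psi> \<circ> hd \<alpha>s) i = Some \<zero>\<^bsub>K\<^esub>)"
    "\<forall>\<^sub>F i in along C. K.eval (map (\<lambda>\<alpha>. the ((map_option \<Psi> \<circ> \<alpha>) i)) \<alpha>s) (the (\<phi> i)) = \<zero>\<^bsub>K\<^esub>"
proof -
  interpret KP: domain K.P by (rule K.domain_power)
  obtain p where "p \<in> carrier (univ_poly K.P power_base)" "p \<noteq> []" and 0: "KP.eval p (K.cls \<phi>) = \<zero>\<^bsub>K.P\<^esub>"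
    using KP.algebraicE[OF subring_power_base K.cls_in_carrier[OF assms(1)] assms(2)] .
  hence p: "set p \<subseteq> power_base" "hd p \<noteq> \<zero>\<^bsub>K.P\<^esub>" "p \<noteq> []"
    by (auto simp flip: univ_poly_carrier simp: polynomial_def)
  have p_image: "set p \<subseteq> (\<lambda>\<alpha>. K.cls (map_option \<Psi> \<circ> \<alpha>)) ` F.funs"
    using p(1) by (force simp: F.carrier_power emb_cls)
  then obtain \<alpha>s where \<alpha>s: "p = map (\<lambda>\<alpha>. K.cls (map_option \<Psi> \<circ> \<alpha>)) \<alpha>s" "set \<alpha>s \<subseteq> F.funs"
    using subset_image_imp_map[OF p_image] by blast
  have funs: "set (map ((\<circ>) (map_option \<Psi>)) \<alpha>s) \<subseteq> K.funs"
    using \<alpha>s(2) map_option_in_funs by auto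
  show thesis
  proof (rule that[OF \<alpha>s(2)])
    show ne: "\<alpha>s \<noteq> []" using p \<alpha>s by auto
    have hd: "hd \<alpha>s \<in> F.funs" using \<alpha>s(2) ne by auto
    have "hd p = K.cls (map_option \<Psi> \<circ> hd \<alpha>s)"
      unfolding \<alpha>s(1) using ne by (rule hd_map)
    thus "\<not> (\<forall>\<^sub>F i in along C. (map_option \<Psi> \<circ> hd \<alpha>s) i = Some \<zero>\<^bsub>K\<^esub>)"
      using p(2) K.cls_eq_zero_iff[OF map_option_in_funs[OF hd]] by metis
    show "\<forall>\<^sub>F i in along C. K.eval (map (\<lambda>\<alpha>. the ((map_option \<Psi> \<circ> \<alpha>) i)) \<alpha>s) (the (\<phi> i)) = \<zero>\<^bsub>K\<^esub>"
      using 0 K.power_eval_eq_zero_iff[OF assms(1) funs] unfolding \<alpha>s(1) by (simp only: list.map_comp o_def simp_thms)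
  qed
qed

text \<open>The constant 1 in front has a nonzero class because the power is a domain. The list of
  classes is therefore a nonzero polynomial whatever the other coefficients are.\<close>

lemma power_algebraicI:
  assumes "\<phi> \<in> K.funs" "set \<alpha>s \<subseteq> F.funs"
    "\<forall>\<^sub>F i in along C. K.eval (\<one>\<^bsub>K\<^esub> # map (\<lambda>\<alpha>. the ((map_option \<Psi> \<circ> \<alpha>) i)) \<alpha>s) (the (\<phi> i)) = \<zero>\<^bsub>K\<^esub>"
  shows "(ring.algebraic K.P over power_base) (K.cls \<phi>)"
proof -
  interpret KP: domain K.P by (rule K.domain_power)
  let ?fs = "(\<lambda>_. Some \<one>\<^bsub>K\<^esub>) # map ((\<circ>) (map_option \<Psi>)) \<alpha>s"
  have funs: "set ?fs \<subseteq> K.funs"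
    using assms(2) map_option_in_funs K.const_in_funs by auto
  have "set (map K.cls ?fs) \<subseteq> power_base"
    using assms(2) subringE(3)[OF subring_power_base] F.cls_in_carrier
    by (auto simp flip: K.power_one emb_cls)
  hence p: "map K.cls ?fs \<in> carrier (univ_poly K.P power_base)"
    using KP.one_not_zero by (simp flip: univ_poly_carrier K.power_one add: polynomial_def)
  have "KP.eval (map K.cls ?fs) (K.cls \<phi>) = \<zero>\<^bsub>K.P\<^esub>"
    unfolding K.power_eval_eq_zero_iff[OF assms(1) funs] using assms(3) by (simp add: o_def)
  from KP.algebraicI[OF p _ this] show ?thesis by simp
qed

section \<open>The two implications between bounded degrees and algebraicity\<close>

lemma degree_bounded_imp_algebraic:
  assumes alg: "algebraic_extension K base"
    and bound: "\<And>x. x \<in> carrier K \<Longrightarrow> deg_over K base x \<le> d"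
  shows "algebraic_extension K.P power_base"
proof -
  obtain e where e: "total_rec 1 e" "\<And>a. a \<in> carrier F \<Longrightarrow> e [a] = \<Psi> a"
    using total_rec_hom by blast
  obtain g where g: "total_rec 2 g"
    "\<And>a b. a \<in> carrier K \<Longrightarrow> b \<in> carrier K \<Longrightarrow> g [a, b] = a \<oplus>\<^bsub>K\<^esub> b"
    using total_rec_field_add[OF K.computable] by blast
  obtain h where h: "total_rec 2 h"
    "\<And>a b. a \<in> carrier K \<Longrightarrow> b \<in> carrier K \<Longrightarrow> h [a, b] = a \<otimes>\<^bsub>K\<^esub> b"
    using total_rec_field_mult[OF K.computable] by blast
  have pow: "\<exists>w. total_rec 1 w \<and> (\<forall>y\<in>carrier K. w [y] = y [^]\<^bsub>K\<^esub> m)" for m :: nat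
  proof (induction m)
    case 0
    show ?case by (intro exI[of _ "\<lambda>_. \<one>\<^bsub>K\<^esub>"]) (simp add: total_rec_const)
  next
    case (Suc m)
    then obtain w where w: "total_rec 1 w" "\<And>y. y \<in> carrier K \<Longrightarrow> w [y] = y [^]\<^bsub>K\<^esub> m" by blast
    have "total_rec 1 (\<lambda>xs. h [w [xs ! 0], xs ! 0])"
      by (intro total_rec_comp2[OF h(1)] total_rec_comp1[OF w(1)] total_rec_proj) auto
    thus ?case by (intro exI conjI) (auto simp: w h)
  qed
  \<comment> \<open>One evaluator is built for each length m: the first decoded coefficient is
    multiplied by the m-th power of y, and the evaluator for the shorter length handles the
    remaining code.\<close>
  have ev: "\<exists>v. total_rec 2 v \<and> (\<forall>y\<in>carrier K. \<forall>n. set (decode_tuple m n) \<subseteq> carrier F \<longrightarrow>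
    v [n, y] = K.eval (map \<Psi> (decode_tuple m n)) y)" for m
  proof (induction m)
    case 0
    show ?case by (intro exI[of _ "\<lambda>_. \<zero>\<^bsub>K\<^esub>"]) (simp add: total_rec_const)
  next
    case (Suc m)
    then obtain v where v: "total_rec 2 v" "\<And>y n. y \<in> carrier K \<Longrightarrow>
      set (decode_tuple m n) \<subseteq> carrier F \<Longrightarrow> v [n, y] = K.eval (map \<Psi> (decode_tuple m n)) y" by blast
    obtain w where w: "total_rec 1 w" "\<And>y. y \<in> carrier K \<Longrightarrow> w [y] = y [^]\<^bsub>K\<^esub> m"
      using pow by blast
    have "K.eval (map \<Psi> (decode_tuple m n)) y \<in> carrier K"
      if "y \<in> carrier K" "set (decode_tuple m n) \<subseteq> carrier F" for n y
      using that hom_closed by (intro K.eval_in_carrier) auto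
    moreover have "total_rec 2 (\<lambda>xs. g [h [e [fst (prod_decode (xs ! 0))], w [xs ! 1]],
        v [snd (prod_decode (xs ! 0)), xs ! 1]])"
      by (intro total_rec_comp2[OF g(1)] total_rec_comp2[OF h(1)] total_rec_comp2[OF v(1)]
        total_rec_comp1[OF w(1)] total_rec_comp1[OF e(1)] total_rec_prod_decode total_rec_proj) auto
    ultimately show ?case by (intro exI conjI) (auto simp: w h g v e hom_closed)
  qed
  obtain v where v: "total_rec 2 v" "\<And>y n. y \<in> carrier K \<Longrightarrow>
      set (decode_tuple d n) \<subseteq> carrier F \<Longrightarrow> v [n, y] = K.eval (map \<Psi> (decode_tuple d n)) y"
    using ev by blast
  obtain w where w: "total_rec 1 w" "\<And>y. y \<in> carrier K \<Longrightarrow> w [y] = y [^]\<^bsub>K\<^esub> d"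
    using pow by blast
  have closed: "K.eval (map \<Psi> (decode_tuple d n)) y \<in> carrier K"
    if "y \<in> carrier K" "set (decode_tuple d n) \<subseteq> carrier F" for n y
    using that hom_closed by (intro K.eval_in_carrier) auto
  \<comment> \<open>Position 0 holds a candidate code and position 1 the element. Outside the
    carrier of \<open>K\<close> the condition is vacuous, so the search ends on every input.\<close>
  define Q where "Q xs \<longleftrightarrow> (xs ! 1 \<in> carrier K \<longrightarrow> (set (decode_tuple d (xs ! 0)) \<subseteq> carrier F \<and>
    g [w [xs ! 1], v [xs ! 0, xs ! 1]] = \<zero>\<^bsub>K\<^esub>))" for xs
  have Q: "Q [n, y] \<longleftrightarrow> set (decode_tuple d n) \<subseteq> carrier F \<and>
    K.eval (\<one>\<^bsub>K\<^esub> # map \<Psi> (decode_tuple d n)) y = \<zero>\<^bsub>K\<^esub>" if "y \<in> carrier K" for n y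
    using that by (auto simp: Q_def v w g closed)
  have "decidable 2 Q" unfolding Q_def using K.computable F.computable
    by (intro decidable_imp decidable_conj decidable_mem decidable_decode_tuple_subset decidable_eq
      total_rec_comp2[OF g(1)] total_rec_comp2[OF v(1)] total_rec_comp1[OF w(1)]
      total_rec_proj total_rec_const) (auto simp: computable_field_def)
  have Q_ex: "\<exists>n. Q [n, y]" for y
  proof (cases "y \<in> carrier K")
    case True
    hence "(ring.algebraic K over base) y" using alg by (simp add: algebraic_extension_def)
    \<comment> \<open>The zero-padded minimal polynomial supplies the tuple; its coefficients are
      pulled back along \<Psi> and then coded.\<close>
    then obtain cs where cs: "length cs = d" "set cs \<subseteq> base" "K.eval (\<one>\<^bsub>K\<^esub> # cs) y = \<zero>\<^bsub>K\<^esub>"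
      using K.monic_annihilator[OF subfield_base True] bound[OF True] unfolding deg_over_def by blast
    then obtain bs where bs: "cs = map \<Psi> bs" "set bs \<subseteq> carrier F"
      using subset_image_imp_map[OF cs(2)] by blast
    then obtain n where "decode_tuple d n = bs" using decode_tuple_surj[of bs] cs(1) by auto
    thus ?thesis using Q[OF True] bs cs by auto
  qed (simp add: Q_def)
  define s where "s xs = (LEAST n. Q (n # xs))" for xs
  have "total_rec 1 s" unfolding s_def using \<open>decidable 2 Q\<close> Q_ex
    by (intro total_rec_Least) (auto simp: numeral_2_eq_2 length_Suc_conv)
  have s: "Q [s [y], y]" for y unfolding s_def by (rule LeastI_ex[OF Q_ex])
  show ?thesis unfolding algebraic_extension_def
  proof
    fix x assume "x \<in> carrier K.P"
    then obtain \<phi> where \<phi>: "\<phi> \<in> K.funs" "x = K.cls \<phi>" by (auto simp: K.carrier_power)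
    \<comment> \<open>The coefficient depends on i only through the value of \<phi> at i. So
      \<open>c j\<close> is a total computable function after \<phi>, and has the same domain as
      \<phi>.\<close>
    define c where "c j i = map_option (\<lambda>y. decode_tuple d (s [y]) ! j) (\<phi> i)" for j i
    have "c j \<in> F.funs" if "j < d" for j
    proof -
      have "total_rec 1 (\<lambda>xs. decode_tuple d (s [xs ! 0]) ! j)"
        by (intro total_rec_decode_tuple_nth total_rec_comp1[OF \<open>total_rec 1 s\<close>] total_rec_proj that) auto
      hence "partial_computable (c j)"
        unfolding c_def using \<phi>(1) partial_computable_map_option[of "\<lambda>xs. decode_tuple d (s [xs ! 0]) ! j"]
        by (simp add: cohesive_funs_def)
      moreover have "decode_tuple d (s [y]) ! j \<in> carrier F" if "\<phi> i = Some y" for i y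
      proof -
        have "y \<in> carrier K" using that \<phi>(1) by (auto simp: cohesive_funs_def ran_def)
        thus ?thesis using s[of y] Q \<open>j < d\<close> nth_mem[of j "decode_tuple d (s [y])"] by auto
      qed
      hence "ran (c j) \<subseteq> carrier F" by (auto simp: c_def ran_def)
      moreover have "dom (c j) = dom \<phi>" by (auto simp: c_def)
      ultimately show ?thesis using \<phi>(1) by (simp add: cohesive_funs_def)
    qed
    hence "set (map c [0..<d]) \<subseteq> F.funs" by auto
    moreover have "\<forall>\<^sub>F i in along C. K.eval (\<one>\<^bsub>K\<^esub> # map (\<lambda>\<alpha>. the ((map_option \<Psi> \<circ> \<alpha>) i)) (map c [0..<d]))
      (the (\<phi> i)) = \<zero>\<^bsub>K\<^esub>"
      using K.funs_defined[OF \<phi>(1)]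
    proof eventually_elim
      case (elim i)
      then obtain y where y: "y \<in> carrier K" "\<phi> i = Some y" by blast
      have "map (\<lambda>\<alpha>. the ((map_option \<Psi> \<circ> \<alpha>) i)) (map c [0..<d]) = map \<Psi> (decode_tuple d (s [y]))"
        by (rule nth_equalityI) (auto simp: c_def y)
      thus ?case using s[of y] Q[OF y(1)] y(2) by simp
    qed
    ultimately show "(ring.algebraic K.P over power_base) x"
      unfolding \<phi>(2) by (rule power_algebraicI[OF \<phi>(1)])
  qed
qed

lemma algebraic_imp_degree_bounded:
  assumes alg: "algebraic_extension K base" and "computable_on (carrier K) (deg_over K base)"
    and power_alg: "algebraic_extension K.P power_base"
  shows "\<exists>d. \<forall>x\<in>carrier K. deg_over K base x \<le> d"
proof (rule ccontr)
  assume "\<not> ?thesis"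
  hence unbounded: "\<exists>x\<in>carrier K. d < deg_over K base x" for d by (meson not_le)
  obtain D where D: "total_rec 1 D" "\<And>x. x \<in> carrier K \<Longrightarrow> D [x] = deg_over K base x"
    using total_rec_extension[OF _ K.zero_closed assms(2)] K.computable
    unfolding computable_field_def by blast
  \<comment> \<open>Position 0 is a candidate element and position 1 the index i that its degree has
    to exceed. Computability of the degree map makes this decidable, and unboundedness makes the
    search succeed for every i.\<close>
  define Q where "Q xs \<longleftrightarrow> xs ! 0 \<in> carrier K \<and> xs ! 1 < D [xs ! 0]" for xs
  have "decidable 2 Q" unfolding Q_def using K.computable
    by (intro decidable_conj decidable_mem decidable_less total_rec_comp1[OF D(1)] total_rec_proj)
      (auto simp: computable_field_def)
  have Q_ex: "\<exists>n. Q [n, i]" for i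
    using unbounded[of i] D(2) by (auto simp: Q_def)
  define s where "s xs = (LEAST n. Q (n # xs))" for xs
  have "total_rec 1 s" unfolding s_def using \<open>decidable 2 Q\<close> Q_ex
    by (intro total_rec_Least) (auto simp: numeral_2_eq_2 length_Suc_conv)
  have "Q [s [i], i]" for i unfolding s_def by (rule LeastI_ex[OF Q_ex])
  hence s: "s [i] \<in> carrier K" "i < deg_over K base (s [i])" for i
    by (simp_all add: Q_def flip: D(2))
  define \<phi> where "\<phi> i = Some (s [i])" for i
  have \<phi>: "\<phi> \<in> K.funs"
    using partial_computable_total[OF \<open>total_rec 1 s\<close>] s(1) unfolding \<phi>_def
    by (auto simp: cohesive_funs_def ran_def almost_subset_iff_eventually)
  have "(ring.algebraic K.P over power_base) (K.cls \<phi>)"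
    using power_alg K.cls_in_carrier[OF \<phi>] by (simp add: algebraic_extension_def)
  then obtain \<alpha>s where \<alpha>s: "set \<alpha>s \<subseteq> F.funs" "\<alpha>s \<noteq> []"
    and nz: "\<not> (\<forall>\<^sub>F i in along C. (map_option \<Psi> \<circ> hd \<alpha>s) i = Some \<zero>\<^bsub>K\<^esub>)"
    and ev: "\<forall>\<^sub>F i in along C. K.eval (map (\<lambda>\<alpha>. the ((map_option \<Psi> \<circ> \<alpha>) i)) \<alpha>s) (the (\<phi> i)) = \<zero>\<^bsub>K\<^esub>"
    using power_algebraicE[OF \<phi>] by blast
  \<comment> \<open>There are finitely many coefficients, so almost everywhere along C all of them
    are defined at once.\<close>
  have "\<forall>\<^sub>F i in along C. \<forall>\<alpha>\<in>set \<alpha>s. \<exists>a\<in>carrier F. \<alpha> i = Some a"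
    using \<alpha>s(1) by (intro eventually_ball_finite) (auto intro: F.funs_defined)
  with ev eventually_along_ge[where n = "length \<alpha>s"]
  have "\<forall>\<^sub>F i in along C. (map_option \<Psi> \<circ> hd \<alpha>s) i = Some \<zero>\<^bsub>K\<^esub>"
  proof eventually_elim
    case (elim i)
    let ?p = "map (\<lambda>\<alpha>. the ((map_option \<Psi> \<circ> \<alpha>) i)) \<alpha>s"
    have "set ?p \<subseteq> base" using elim(3) by force
    moreover have "(ring.algebraic K over base) (s [i])"
      using alg s(1) by (simp add: algebraic_extension_def)
    moreover have "\<not> deg_over K base (s [i]) \<le> length ?p - 1"
      using s(2)[of i] elim(2) by simp
    \<comment> \<open>With a nonzero head, \<open>?p\<close> would bound the degree of
      \<open>s [i]\<close> by \<open>length ?p - 1\<close>. This is below i, whereas the degree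
      exceeds i.\<close>
    ultimately have "hd ?p = \<zero>\<^bsub>K\<^esub>"
      using K.degree_Irr_le[OF subfield_base s(1), of i ?p] elim(1) \<alpha>s(2)
      by (auto simp: deg_over_def \<phi>_def)
    moreover obtain a where "hd \<alpha>s i = Some a" using elim(3) hd_in_set[OF \<alpha>s(2)] by blast
    ultimately show ?case using \<alpha>s(2) by (simp add: hd_map)
  qed
  with nz show False by contradiction
qed

end

theorem corollary4p9:
  fixes K F :: "nat ring" and \<Psi> :: "nat \<Rightarrow> nat" and C :: "nat set"
  assumes "computable_field_extension K F \<Psi>"
    and "algebraic_extension K (\<Psi> ` carrier F)"
    and "computable_on (carrier K) (deg_over K (\<Psi> ` carrier F))"
    and "cohesive C"
  shows "algebraic_extension (cohesive_power C K)
           (cohesive_embedding C K \<Psi> ` carrier (cohesive_power C F))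
         \<longleftrightarrow> bdd_above {deg_over K (\<Psi> ` carrier F) \<alpha> | \<alpha>. \<alpha> \<in> carrier K}"
proof -
  interpret K: field K using assms(1) by (simp add: computable_field_extension_def computable_field_def)
  interpret F: field F using assms(1) by (simp add: computable_field_extension_def computable_field_def)
  interpret computable_extension K F C \<Psi>
    by unfold_locales (use assms in \<open>simp_all add: computable_field_extension_def\<close>)
  have bdd: "bdd_above {deg_over K base \<alpha> | \<alpha>. \<alpha> \<in> carrier K}
      \<longleftrightarrow> (\<exists>d. \<forall>x\<in>carrier K. deg_over K base x \<le> d)"
    by (auto simp: bdd_above_def)
  show ?thesis
    unfolding bdd
  proof
    assume "algebraic_extension K.P power_base"
    thus "\<exists>d. \<forall>x\<in>carrier K. deg_over K base x \<le> d"
      by (rule algebraic_imp_degree_bounded[OF assms(2,3)])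
  next
    assume "\<exists>d. \<forall>x\<in>carrier K. deg_over K base x \<le> d"
    then obtain d where "\<forall>x\<in>carrier K. deg_over K base x \<le> d" ..
    thus "algebraic_extension K.P power_base"
      by (intro degree_bounded_imp_algebraic[OF assms(2), of d]) (rule bspec)
  qed
qed

end
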